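(* Every $P_5$-free $t$-perfect graph $G$ is $3$-colourable.
   Context: All graphs are finite and simple. A graph is $P_5$-free if it does not contain the path on five vertices as an induced subgraph. The stable set polytope $\mathrm{SSP}(G)\subseteq\mathbb{R}^{V}$ of $G=(V,E)$ is the convex hull of the characteristic vectors of stable (independent) subsets of $V$. The polytope $\mathrm{TSTAB}(G)\subseteq\mathbb{R}^{V}$ is given by: $x\ge 0$; $x_u+x_v\le 1$ for every edge $uv\in E$; and $\sum_{v\in V(C)}x_v\le\lfloor |C|/2\rfloor$ for every induced odd cycle $C$ in $G$. The graph $G$ is $t$-perfect if $\mathrm{SSP}(G)=\mathrm{TSTAB}(G)$. *)

theory Defs
  imports "HOL-Analysis.Analysis" "Graph_Theory.Pair_Digraph"
begin

text \<open>
  A finite simple graph is a \<^locale>\<open>pair_graph\<close>: a finite vertex set with a symmetric irreflexive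
  set of arcs, each undirected edge being represented by its two orientations. The vertex set is an
  arbitrary (possibly empty) subset of a finite type \<open>'a\<close>, and \<open>\<real>\<^sup>V\<close> is the coordinate subspace of
  \<open>real ^ 'a\<close> of the vectors that vanish outside \<open>V\<close>.
\<close>

definition induced_embedding ::
    "'b pair_pre_digraph \<Rightarrow> 'a pair_pre_digraph \<Rightarrow> ('b \<Rightarrow> 'a) \<Rightarrow> bool" where
  "induced_embedding H G f \<longleftrightarrow>
     inj_on f (pverts H) \<and> f ` pverts H \<subseteq> pverts G \<and>
     (\<forall>u\<in>pverts H. \<forall>v\<in>pverts H. (u, v) \<in> parcs H \<longleftrightarrow> (f u, f v) \<in> parcs G)"

definition induced_free :: "'b pair_pre_digraph \<Rightarrow> 'a pair_pre_digraph \<Rightarrow> bool" where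
  "induced_free H G \<longleftrightarrow> (\<nexists>f. induced_embedding H G f)"

definition path_graph :: "nat \<Rightarrow> nat pair_pre_digraph" where
  "path_graph n =
     \<lparr>pverts = {..<n}, parcs = {(i, j). i < n \<and> j < n \<and> (j = Suc i \<or> i = Suc j)}\<rparr>"

text \<open>Only meant for \<open>n \<ge> 3\<close>; the case \<open>n = 3\<close> is the triangle.\<close>

definition cycle_graph :: "nat \<Rightarrow> nat pair_pre_digraph" where
  "cycle_graph n =
     \<lparr>pverts = {..<n}, parcs = {(i, j). i < n \<and> j < n \<and> (j = Suc i mod n \<or> i = Suc j mod n)}\<rparr>"

definition stable_set :: "'a pair_pre_digraph \<Rightarrow> 'a set \<Rightarrow> bool" where
  "stable_set G S \<longleftrightarrow> S \<subseteq> pverts G \<and> (\<forall>u\<in>S. \<forall>v\<in>S. (u, v) \<notin> parcs G)"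

definition SSP :: "'a::finite pair_pre_digraph \<Rightarrow> (real ^ 'a) set" where
  "SSP G = convex hull {(\<chi> v. indicator S v) | S. stable_set G S}"

definition TSTAB :: "'a::finite pair_pre_digraph \<Rightarrow> (real ^ 'a) set" where
  "TSTAB G = {x.
     (\<forall>v. v \<notin> pverts G \<longrightarrow> x $ v = 0) \<and>
     (\<forall>v\<in>pverts G. 0 \<le> x $ v) \<and>
     (\<forall>(u, v)\<in>parcs G. x $ u + x $ v \<le> 1) \<and>
     (\<forall>n f. odd n \<and> n \<ge> 3 \<and> induced_embedding (cycle_graph n) G f \<longrightarrow>
        (\<Sum>v\<in>f ` pverts (cycle_graph n). x $ v) \<le> real (n div 2))}"

definition t_perfect :: "'a::finite pair_pre_digraph \<Rightarrow> bool" where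
  "t_perfect G \<longleftrightarrow> SSP G = TSTAB G"

definition colourable :: "nat \<Rightarrow> 'a pair_pre_digraph \<Rightarrow> bool" where
  "colourable k G \<longleftrightarrow>
     (\<exists>c :: 'a \<Rightarrow> nat. (\<forall>v\<in>pverts G. c v < k) \<and> (\<forall>(u, v)\<in>parcs G. c u \<noteq> c v))"

end

theory Submission
  imports Defs
begin

text \<open>
  The vector with all coordinates \<open>1/3\<close> lies in \<open>TSTAB G\<close>, so in a \<open>t\<close>-perfect graph it is a convex
  combination of stable sets. Triangle inequalities are tight at it, hence every stable set of the
  combination meets every triangle. So there are stable sets that meet all triangles, and
  averaging over the combination shows more: every list of vertices has at least a third of its
  entries in one of them (\<open>t_perfect_transversal_majority\<close>). This excludes wheels over a pentagon, the
  Moser spindle and some larger graphs. A second vector of \<open>TSTAB G\<close>, with a coordinate \<open>2/3\<close>,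
  excludes a vertex with exactly four neighbours on an induced pentagon
  (\<open>t_perfect_no_four_on_pentagon\<close>). Only these two consequences of \<open>t\<close>-perfection are needed
  besides the absence of an induced path on five vertices.

  Fix a stable set \<open>S\<close> that meets all triangles. In a graph without induced \<open>P\<^sub>5\<close> the only
  induced odd cycles are triangles and pentagons. If no pentagon avoids \<open>S\<close>, then the complement of
  \<open>S\<close> is bipartite and \<open>S\<close> is a third colour class. In general, a pentagon that avoids \<open>S\<close> extends
  to a blow-up with stable classes \<open>V 0\<close>, ..., \<open>V 4\<close>, which is a union of components of the complement
  of \<open>S\<close> (\<open>pentagon_blowup_exists\<close>). The blow-up, its neighbours in \<open>S\<close> and the remaining vertices
  adjacent to the latter form a union of components of the whole graph
  (\<open>closed_neighbourhood\<close>), so it is enough to colour such sets one by one.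

  Give the class \<open>V j\<close> a colour of its own and let the two other colours alternate on the remaining
  four classes. A vertex of \<open>S\<close> then sees all three colours only if it has neighbours in three
  consecutive classes that include \<open>V j\<close> (an arc), or in \<open>V j\<close> and the two opposite classes (a fork at
  \<open>j\<close>). The vertices outside the blow-up and \<open>S\<close> are attached to forks only; an edge among them needs
  two colours, so forks attached to such an edge must be able to take the third one, which
  forbids them at \<open>j + 2\<close> and \<open>j + 3\<close>. It remains to find an index \<open>j\<close> without obstruction. Certain
  pairs and triples of obstructions cannot occur together, because they produce an induced \<open>P\<^sub>5\<close> or
  a small subgraph excluded by averaging; given these incompatibilities, the existence of \<open>j\<close> is a
  combinatorial fact about the integers modulo \<open>5\<close> (\<open>pentagon_index_exists\<close>).
\<close>

section \<open>Colourings and closed sets\<close>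

text \<open>Adjacency is a relation on the whole type: vertices outside a graph are isolated, which is
  harmless for colourings.\<close>

definition triangle_transversal :: "('a \<Rightarrow> 'a \<Rightarrow> bool) \<Rightarrow> 'a set \<Rightarrow> bool" where
  "triangle_transversal adj S \<longleftrightarrow>
     (\<forall>u\<in>S. \<forall>v\<in>S. \<not> adj u v) \<and>
     (\<forall>a b c. adj a b \<longrightarrow> adj b c \<longrightarrow> adj a c \<longrightarrow> a \<in> S \<or> b \<in> S \<or> c \<in> S)"

locale P5_free =
  fixes adj :: "'a::finite \<Rightarrow> 'a \<Rightarrow> bool"
  assumes sym: "adj u v \<Longrightarrow> adj v u"
    and irrefl: "\<not> adj v v"
    and no_P5: "\<lbrakk>adj a b; adj b c; adj c d; adj d e; \<not> adj a c; \<not> adj a d; \<not> adj a e;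
                 \<not> adj b d; \<not> adj b e; \<not> adj c e\<rbrakk> \<Longrightarrow> False"
begin

definition colourable_on :: "nat \<Rightarrow> 'a set \<Rightarrow> bool" where
  "colourable_on k W \<longleftrightarrow> (\<exists>c. (\<forall>v\<in>W. c v < k) \<and> (\<forall>u\<in>W. \<forall>v\<in>W. adj u v \<longrightarrow> c u \<noteq> c v))"

definition closed_in :: "'a set \<Rightarrow> 'a set \<Rightarrow> bool" where
  "closed_in X W \<longleftrightarrow> W \<subseteq> X \<and> (\<forall>u\<in>W. \<forall>v\<in>X. adj u v \<longrightarrow> v \<in> W)"

definition pentagon :: "'a \<Rightarrow> 'a \<Rightarrow> 'a \<Rightarrow> 'a \<Rightarrow> 'a \<Rightarrow> bool" where
  "pentagon a b c d e \<longleftrightarrow> adj a b \<and> adj b c \<and> adj c d \<and> adj d e \<and> adj e a \<and>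
     \<not> adj a c \<and> \<not> adj a d \<and> \<not> adj b d \<and> \<not> adj b e \<and> \<not> adj c e"

lemma colourable_on_Un:
  assumes "closed_in X U" "closed_in X W" "colourable_on k U" "colourable_on k W"
  shows "colourable_on k (U \<union> W)"
proof -
  obtain f where f: "\<forall>v\<in>U. f v < k" "\<forall>u\<in>U. \<forall>v\<in>U. adj u v \<longrightarrow> f u \<noteq> f v"
    using assms(3) unfolding colourable_on_def by blast
  obtain g where g: "\<forall>v\<in>W. g v < k" "\<forall>u\<in>W. \<forall>v\<in>W. adj u v \<longrightarrow> g u \<noteq> g v"
    using assms(4) unfolding colourable_on_def by blast
  have "\<And>u v. u \<in> U \<Longrightarrow> v \<in> W \<Longrightarrow> adj u v \<Longrightarrow> v \<in> U"
    using assms(1,2) unfolding closed_in_def by blast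
  then have "\<forall>u\<in>U \<union> W. \<forall>v\<in>U \<union> W. adj u v \<longrightarrow>
      (if u \<in> U then f u else g u) \<noteq> (if v \<in> U then f v else g v)"
    using f(2) g(2) sym by (metis Un_iff)
  moreover have "\<forall>v\<in>U \<union> W. (if v \<in> U then f v else g v) < k"
    using f(1) g(1) by auto
  ultimately show ?thesis unfolding colourable_on_def by (intro exI conjI)
qed

lemma closed_in_Un: "closed_in X U \<Longrightarrow> closed_in X W \<Longrightarrow> closed_in X (U \<union> W)"
  unfolding closed_in_def by blast

text \<open>Closed sets are unions of components; this replaces an argument component by component.\<close>

lemma colourable_on_if_locally:
  assumes "\<And>v. v \<in> X \<Longrightarrow> \<exists>W. v \<in> W \<and> closed_in X W \<and> colourable_on k W"
  shows "colourable_on k X"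
proof -
  have "\<exists>W. F \<subseteq> W \<and> closed_in X W \<and> colourable_on k W" if "finite F" "F \<subseteq> X" for F
    using that
  proof (induction F rule: finite_induct)
    case empty
    have "closed_in X {} \<and> colourable_on k {}" unfolding closed_in_def colourable_on_def by simp
    then show ?case by blast
  next
    case (insert v F)
    then obtain W where "F \<subseteq> W" "closed_in X W" "colourable_on k W" by auto
    moreover obtain W' where "v \<in> W'" "closed_in X W'" "colourable_on k W'"
      using assms insert.prems by blast
    ultimately show ?case
      using colourable_on_Un closed_in_Un by (intro exI[of _ "W \<union> W'"]) auto
  qed
  from this[of X] obtain W where "X \<subseteq> W" "closed_in X W" "colourable_on k W" by auto
  then show ?thesis unfolding closed_in_def by (metis subset_antisym)
qed

section \<open>Pentagons in graphs without induced paths on five vertices\<close>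

text \<open>Breadth-first search from a vertex \<open>v\<close>. A shortest path from \<open>v\<close> is induced, so there are at
  most three levels. An edge inside a level closes a triangle or a pentagon in the first two
  levels, and a triangle or an induced \<open>P\<^sub>5\<close> in the third; so the parity of the level is a colouring of the
  component of \<open>v\<close>.\<close>

lemma two_colourable_if_no_short_odd_cycle:
  assumes tri: "\<And>a b c. \<lbrakk>a \<in> X; b \<in> X; c \<in> X; adj a b; adj b c; adj a c\<rbrakk> \<Longrightarrow> False"
    and pent5: "\<And>a b c d e. \<lbrakk>a \<in> X; b \<in> X; c \<in> X; d \<in> X; e \<in> X; pentagon a b c d e\<rbrakk> \<Longrightarrow> False"
  shows "colourable_on 2 X"
proof (rule colourable_on_if_locally)
  fix v assume v: "v \<in> X"
  define N1 where "N1 = {x\<in>X. adj v x}"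
  define N2 where "N2 = {x\<in>X. x \<noteq> v \<and> x \<notin> N1 \<and> (\<exists>p\<in>N1. adj p x)}"
  define N3 where "N3 = {x\<in>X. x \<noteq> v \<and> x \<notin> N1 \<and> x \<notin> N2 \<and> (\<exists>p\<in>N2. adj p x)}"
  define A where "A = insert v N2"
  define B where "B = N1 \<union> N3"
  have N1: "\<not> adj x y" if "x \<in> N1" "y \<in> N1" for x y
    using that tri v unfolding N1_def by blast
  have N2: "\<not> adj x y" if xy: "x \<in> N2" "y \<in> N2" for x y
  proof
    assume "adj x y"
    obtain p q where pq: "p \<in> N1" "adj p x" "q \<in> N1" "adj q y"
      using xy unfolding N2_def by blast
    have X: "x \<in> X" "y \<in> X" "p \<in> X" "q \<in> X" "adj v p" "adj v q" "\<not> adj v x" "\<not> adj v y"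
      using xy pq unfolding N1_def N2_def by auto
    have "\<not> adj p y" "\<not> adj q x" using tri X pq \<open>adj x y\<close> sym by blast+
    then have "pentagon v p x y q"
      unfolding pentagon_def using X pq \<open>adj x y\<close> N1 sym by blast
    then show False using pent5 X v by blast
  qed
  have far: "\<exists>p p'. adj v p' \<and> adj p' p \<and> adj p x \<and> \<not> adj v p \<and> \<not> adj v x \<and> \<not> adj p' x \<and> p \<in> X \<and> p \<in> N2 \<and> p' \<in> N1"
    if x: "x \<in> N3" for x
  proof -
    obtain p where p: "p \<in> N2" "adj p x" using x unfolding N3_def by blast
    obtain p' where p': "p' \<in> N1" "adj p' p" using p unfolding N2_def by blast
    have "\<not> adj p' x" using x p' unfolding N3_def N2_def by blast
    moreover have "adj v p'" "\<not> adj v p" "\<not> adj v x" "p \<in> X"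
      using p(1) p'(1) x unfolding N1_def N2_def N3_def by auto
    ultimately show ?thesis using p p' by blast
  qed
  have N3: "\<not> adj x y" if xy: "x \<in> N3" "y \<in> N3" for x y
  proof
    assume "adj x y"
    obtain p p' where p: "adj v p'" "adj p' p" "adj p x" "\<not> adj v p" "\<not> adj v x" "\<not> adj p' x" "p \<in> X"
      and p'X: "p' \<in> N1"
      using far[OF xy(1)] by blast
    have y: "y \<in> X" "y \<notin> N1" "y \<notin> N2" "y \<noteq> v" and "x \<in> X"
      using xy unfolding N3_def by auto
    have "\<not> adj v y" using y unfolding N1_def by simp
    moreover have "\<not> adj p' y"
      using y p(1) p'X unfolding N2_def N1_def by blast
    moreover have "\<not> adj p y" using tri p \<open>adj x y\<close> \<open>x \<in> X\<close> \<open>y \<in> X\<close> by blast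
    ultimately show False using no_P5[of v p' p x y] p \<open>adj x y\<close> by blast
  qed
  have AB: "A \<inter> B = {}" unfolding A_def B_def N2_def N3_def N1_def using irrefl by blast
  have stA: "\<not> adj x y" if "x \<in> A" "y \<in> A" for x y
    using that N2 sym irrefl unfolding A_def N1_def N2_def by blast
  have N13: "\<not> adj x y" if "x \<in> N1" "y \<in> N3" for x y
    using that unfolding N1_def N2_def N3_def by blast
  have stB: "\<not> adj x y" if "x \<in> B" "y \<in> B" for x y
    using that N1 N3 N13 sym unfolding B_def by blast
  have "closed_in X (A \<union> B)"
  proof -
    have "y \<in> A \<union> B" if "x \<in> A \<union> B" "y \<in> X" "adj x y" for x y
    proof (cases "x \<in> N3")
      case True
      obtain p p' where p: "adj v p'" "adj p' p" "adj p x" "\<not> adj v p" "\<not> adj v x" "\<not> adj p' x"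
        "p' \<in> N1" "p \<in> N2"
        using far[OF True] by blast
      show ?thesis
      proof (rule ccontr)
        assume y: "y \<notin> A \<union> B"
        then have *: "y \<noteq> v" "y \<notin> N1" "y \<notin> N2" "y \<notin> N3"
          unfolding A_def B_def by auto
        have "\<not> adj v y" using * that(2) unfolding N1_def by simp
        moreover have "\<not> adj p' y" using * that(2) p(7) unfolding N2_def by blast
        moreover have "\<not> adj p y" using * that(2) p(8) unfolding N3_def by blast
        ultimately show False using no_P5[of v p' p x y] p that(3) by blast
      qed
    next
      case False
      then have "x = v \<or> x \<in> N1 \<or> x \<in> N2"
        using that(1) unfolding A_def B_def by blast
      then consider "x = v" | "x \<in> N1" | "x \<in> N2" by blast
      then show ?thesis
      proof cases
        case 1
        then show ?thesis using that unfolding B_def N1_def by simp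
      next
        case 2
        then show ?thesis using that unfolding A_def B_def N2_def by blast
      next
        case 3
        then show ?thesis using that unfolding A_def B_def N3_def by blast
      qed
    qed
    moreover have "A \<union> B \<subseteq> X" using v unfolding A_def B_def N3_def N2_def N1_def by blast
    ultimately show ?thesis unfolding closed_in_def by blast
  qed
  moreover have "colourable_on 2 (A \<union> B)"
    unfolding colourable_on_def
    using AB stA stB by (intro exI[of _ "\<lambda>x. if x \<in> A then 0 else 1"]) auto
  moreover have "v \<in> A \<union> B" unfolding A_def by simp
  ultimately show "\<exists>W. v \<in> W \<and> closed_in X W \<and> colourable_on 2 W" by blast
qed

lemma pentagon_rotate: "pentagon a b c d e \<Longrightarrow> pentagon b c d e a"
  unfolding pentagon_def using sym by blast

text \<open>These two exclusions leave as neighbourhoods on a pentagon, up to rotation and apart from the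
  empty one, only two vertices at distance two, three vertices, four, or all five.\<close>

lemma pentagon_nbr_not_single:
  "\<lbrakk>pentagon a b c d e; adj s a; \<not> adj s b; \<not> adj s c; \<not> adj s d\<rbrakk> \<Longrightarrow> False"
  using no_P5[of s a b c d] unfolding pentagon_def by blast

lemma pentagon_nbr_not_edge:
  "\<lbrakk>pentagon a b c d e; adj s a; adj s b; \<not> adj s c; \<not> adj s d; \<not> adj s e\<rbrakk> \<Longrightarrow> False"
  using no_P5[of s b c d e] sym unfolding pentagon_def by blast

end

section \<open>Subgraphs excluded by averaging\<close>

text \<open>The majority axiom is the form in which a convex combination of triangle transversals that
  covers every vertex with weight \<open>1/3\<close> gets used. Vertices are listed with repetition so
  that a list can express integer weights.\<close>

locale majority_P5_free = P5_free +
  assumes majority: "\<exists>S. triangle_transversal adj S \<and> length xs \<le> 3 * length (filter (\<lambda>x. x \<in> S) xs)"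
    and no_four_on_pentagon: "\<lbrakk>pentagon a b c d e; adj s a; adj s b; adj s c; adj s d; \<not> adj s e\<rbrakk> \<Longrightarrow> False"
begin

text \<open>Some transversal contains two vertices of the pentagon and hence not \<open>s\<close>. It then meets each
  edge of the pentagon, which forms a triangle with \<open>s\<close>, exactly once. That is impossible on
  an odd cycle.\<close>

lemma no_five_on_pentagon:
  assumes "pentagon a b c d e" "adj s a" "adj s b" "adj s c" "adj s d" "adj s e"
  shows False
proof -
  obtain S where S: "triangle_transversal adj S"
    "length [a,b,c,d,e] \<le> 3 * length (filter (\<lambda>x. x \<in> S) [a,b,c,d,e])"
    using majority by blast
  have "s \<notin> S \<or> (a \<notin> S \<and> b \<notin> S \<and> c \<notin> S \<and> d \<notin> S \<and> e \<notin> S)"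
    using S(1) assms unfolding triangle_transversal_def by blast
  then have "s \<notin> S" using S(2) by auto
  then have "a \<in> S \<or> b \<in> S" "b \<in> S \<or> c \<in> S" "c \<in> S \<or> d \<in> S" "d \<in> S \<or> e \<in> S" "e \<in> S \<or> a \<in> S"
    using S(1) assms unfolding triangle_transversal_def pentagon_def by blast+
  moreover have "\<not> (a \<in> S \<and> b \<in> S)" "\<not> (b \<in> S \<and> c \<in> S)" "\<not> (c \<in> S \<and> d \<in> S)"
    "\<not> (d \<in> S \<and> e \<in> S)" "\<not> (e \<in> S \<and> a \<in> S)"
    using S(1) assms(1) unfolding triangle_transversal_def pentagon_def by blast+
  ultimately show False by blast
qed

text \<open>The edges form a Moser spindle. It has no three independent vertices, so no stable set contains
  a third of the seven.\<close>

lemma no_moser_spindle: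
  assumes "pentagon c0 c1 c2 c3 c4" "adj b c4" "adj b c0" "adj b c1" "adj b' c1" "adj b' c2" "adj b' c3"
  shows False
proof -
  obtain S where S: "triangle_transversal adj S"
    "length [c0,c1,c2,c3,c4,b,b'] \<le> 3 * length (filter (\<lambda>x. x \<in> S) [c0,c1,c2,c3,c4,b,b'])"
    using majority by blast
  have "\<not> (c0 \<in> S \<and> c1 \<in> S)" "\<not> (c1 \<in> S \<and> c2 \<in> S)" "\<not> (c2 \<in> S \<and> c3 \<in> S)"
    "\<not> (c3 \<in> S \<and> c4 \<in> S)" "\<not> (c4 \<in> S \<and> c0 \<in> S)"
    "\<not> (b \<in> S \<and> c4 \<in> S)" "\<not> (b \<in> S \<and> c0 \<in> S)" "\<not> (b \<in> S \<and> c1 \<in> S)"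
    "\<not> (b' \<in> S \<and> c1 \<in> S)" "\<not> (b' \<in> S \<and> c2 \<in> S)" "\<not> (b' \<in> S \<and> c3 \<in> S)"
    using S(1) assms unfolding triangle_transversal_def pentagon_def by blast+
  with S(2) show False by (simp split: if_splits)
qed

text \<open>The two triangles on \<open>w w'\<close> force a transversal to contain both or none of \<open>d\<close> and \<open>d'\<close>. In
  the first case it has no further vertex in the configuration. The vertex \<open>d\<close> is
  listed twice to make this case, too, fall short of a third.\<close>

lemma no_next_forks_on_edge:
  assumes "pentagon c0 c1 c2 c3 c4" "adj d c0" "adj d c2" "adj d c3" "adj d' c1" "adj d' c3" "adj d' c4"
    "adj w w'" "adj d w" "adj d w'" "adj d' w" "adj d' w'"
  shows False
proof -
  let ?l = "[d,d,d',w,w',c0,c1,c2,c3,c4]"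
  obtain S where S: "triangle_transversal adj S"
    "length ?l \<le> 3 * length (filter (\<lambda>x. x \<in> S) ?l)"
    using majority by blast
  have "\<not> (c0 \<in> S \<and> c1 \<in> S)" "\<not> (c1 \<in> S \<and> c2 \<in> S)" "\<not> (c2 \<in> S \<and> c3 \<in> S)"
    "\<not> (c3 \<in> S \<and> c4 \<in> S)" "\<not> (c4 \<in> S \<and> c0 \<in> S)"
    "\<not> (d \<in> S \<and> c0 \<in> S)" "\<not> (d \<in> S \<and> c2 \<in> S)" "\<not> (d \<in> S \<and> c3 \<in> S)"
    "\<not> (d' \<in> S \<and> c1 \<in> S)" "\<not> (d' \<in> S \<and> c3 \<in> S)" "\<not> (d' \<in> S \<and> c4 \<in> S)"
    "\<not> (w \<in> S \<and> w' \<in> S)"  "\<not> (d \<in> S \<and> w \<in> S)" "\<not> (d \<in> S \<and> w' \<in> S)"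
    "\<not> (d' \<in> S \<and> w \<in> S)" "\<not> (d' \<in> S \<and> w' \<in> S)"
    "d \<in> S \<or> w \<in> S \<or> w' \<in> S" "d' \<in> S \<or> w \<in> S \<or> w' \<in> S"
    "d \<in> S \<or> c2 \<in> S \<or> c3 \<in> S" "d' \<in> S \<or> c3 \<in> S \<or> c4 \<in> S"
    using S(1) assms unfolding triangle_transversal_def pentagon_def by blast+
  with S(2) show False by (simp split: if_splits)
qed

text \<open>Again \<open>d\<close> and \<open>d'\<close> occur together or not at all in a transversal, and in either case it contains
  at most three of the ten vertices.\<close>

lemma no_second_forks_on_edge_with_arc:
  assumes "pentagon c0 c1 c2 c3 c4" "adj d c0" "adj d c2" "adj d c3" "adj d' c2" "adj d' c4" "adj d' c0"
    "adj b c0" "adj b c1" "adj b c2"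
    "adj w w'" "adj d w" "adj d w'" "adj d' w" "adj d' w'"
  shows False
proof -
  let ?l = "[d,d',w,w',b,c0,c1,c2,c3,c4]"
  obtain S where S: "triangle_transversal adj S"
    "length ?l \<le> 3 * length (filter (\<lambda>x. x \<in> S) ?l)"
    using majority by blast
  have "\<not> (c0 \<in> S \<and> c1 \<in> S)" "\<not> (c1 \<in> S \<and> c2 \<in> S)" "\<not> (c2 \<in> S \<and> c3 \<in> S)"
    "\<not> (c3 \<in> S \<and> c4 \<in> S)" "\<not> (c4 \<in> S \<and> c0 \<in> S)"
    "\<not> (d \<in> S \<and> c0 \<in> S)" "\<not> (d \<in> S \<and> c2 \<in> S)" "\<not> (d \<in> S \<and> c3 \<in> S)"
    "\<not> (d' \<in> S \<and> c2 \<in> S)" "\<not> (d' \<in> S \<and> c4 \<in> S)" "\<not> (d' \<in> S \<and> c0 \<in> S)"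
    "\<not> (b \<in> S \<and> c0 \<in> S)" "\<not> (b \<in> S \<and> c1 \<in> S)" "\<not> (b \<in> S \<and> c2 \<in> S)"
    "\<not> (w \<in> S \<and> w' \<in> S)"  "\<not> (d \<in> S \<and> w \<in> S)" "\<not> (d \<in> S \<and> w' \<in> S)"
    "\<not> (d' \<in> S \<and> w \<in> S)" "\<not> (d' \<in> S \<and> w' \<in> S)"
    "d \<in> S \<or> w \<in> S \<or> w' \<in> S" "d' \<in> S \<or> w \<in> S \<or> w' \<in> S"
    "d \<in> S \<or> c2 \<in> S \<or> c3 \<in> S" "d' \<in> S \<or> c4 \<in> S \<or> c0 \<in> S"
    "b \<in> S \<or> c0 \<in> S \<or> c1 \<in> S" "b \<in> S \<or> c1 \<in> S \<or> c2 \<in> S"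
    using S(1) assms unfolding triangle_transversal_def pentagon_def by blast+
  with S(2) show False by (simp split: if_splits)
qed

end

section \<open>Blow-ups of a pentagon and their neighbours\<close>

context P5_free begin

text \<open>The five classes are indexed periodically by integers, so that rotations are index shifts and
  index arithmetic needs no explicit reduction.\<close>

definition blowup :: "(int \<Rightarrow> 'a set) \<Rightarrow> bool" where
  "blowup V \<longleftrightarrow> (\<forall>i. V (i + 5) = V i) \<and> (\<forall>i. V i \<noteq> {}) \<and>
     (\<forall>i. \<forall>x\<in>V i. \<forall>y\<in>V i. \<not> adj x y) \<and>
     (\<forall>i. \<forall>x\<in>V i. \<forall>y\<in>V (i + 1). adj x y) \<and>
     (\<forall>i. \<forall>x\<in>V i. \<forall>y\<in>V (i + 2). \<not> adj x y)"

end

locale pentagon_blowup = majority_P5_free +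
  fixes S :: "'a set" and V :: "int \<Rightarrow> 'a set"
  assumes S_transversal: "triangle_transversal adj S"
    and V_blowup: "blowup V"
    and VS: "V i \<inter> S = {}"
    and V_closed: "\<lbrakk>x \<in> V i; adj x z; z \<notin> S\<rbrakk> \<Longrightarrow> \<exists>k. z \<in> V k"
begin

lemma V_wrap: "V (j + 5) = V j" "V (j + 6) = V (j + 1)" "V (j + 7) = V (j + 2)" "V (j + 8) = V (j + 3)"
proof -
  have w: "\<And>i. V (i + 5) = V i" using V_blowup unfolding blowup_def by blast
  show "V (j + 5) = V j" "V (j + 6) = V (j + 1)" "V (j + 7) = V (j + 2)" "V (j + 8) = V (j + 3)"
    using w[of j] w[of "j + 1"] w[of "j + 2"] w[of "j + 3"] by (simp_all add: add.assoc)
qed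

lemma V_nonempty: "\<exists>x. x \<in> V i"
  using V_blowup unfolding blowup_def by blast

lemma V_stable: "x \<in> V i \<Longrightarrow> y \<in> V i \<Longrightarrow> \<not> adj x y"
  using V_blowup unfolding blowup_def by blast

text \<open>Any choice of representatives is an induced pentagon. Most arguments below
  choose representatives that are neighbours of the vertices of \<open>S\<close> under consideration.\<close>

lemma V_pentagon:
  assumes "x0 \<in> V j" "x1 \<in> V (j + 1)" "x2 \<in> V (j + 2)" "x3 \<in> V (j + 3)" "x4 \<in> V (j + 4)"
  shows "pentagon x0 x1 x2 x3 x4"
proof -
  have next_class: "\<And>i x y. x \<in> V i \<Longrightarrow> y \<in> V (i + 1) \<Longrightarrow> adj x y"
    and two_on: "\<And>i x y. x \<in> V i \<Longrightarrow> y \<in> V (i + 2) \<Longrightarrow> \<not> adj x y"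
    using V_blowup unfolding blowup_def by blast+
  have "adj x0 x1" "adj x1 x2" "adj x2 x3" "adj x3 x4" "adj x4 x0"
    using next_class[of x0 j x1] next_class[of x1 "j + 1" x2] next_class[of x2 "j + 2" x3]
      next_class[of x3 "j + 3" x4] next_class[of x4 "j + 4" x0] assms V_wrap(1)[of j]
    by (simp_all add: add.assoc)
  moreover have "\<not> adj x0 x2" "\<not> adj x1 x3" "\<not> adj x2 x4" "\<not> adj x3 x0" "\<not> adj x4 x1"
    using two_on[of x0 j x2] two_on[of x1 "j + 1" x3] two_on[of x2 "j + 2" x4]
      two_on[of x3 "j + 3" x0] two_on[of x4 "j + 4" x1] assms V_wrap[of j]
    by (simp_all add: add.assoc)
  ultimately show ?thesis unfolding pentagon_def using sym by blast
qed

lemma V_adj: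
  assumes "x \<in> V j"
  shows "y \<in> V (j + 1) \<Longrightarrow> adj x y" "y \<in> V (j + 2) \<Longrightarrow> \<not> adj x y"
    "y \<in> V (j + 3) \<Longrightarrow> \<not> adj x y" "y \<in> V (j + 4) \<Longrightarrow> adj x y"
  using V_pentagon[of x j] V_nonempty assms unfolding pentagon_def by (metis sym)+

definition meets :: "'a \<Rightarrow> int \<Rightarrow> bool" where
  "meets s i \<longleftrightarrow> (\<exists>x\<in>V i. adj s x)"

text \<open>By the exclusions for a single pentagon, a vertex of \<open>S\<close> with neighbours in the blow-up has
  them in two classes at distance two, in three consecutive classes (an arc centred at \<open>j\<close>), or in
  a class and the two opposite ones (a fork at \<open>j\<close>).\<close>

definition arc :: "'a \<Rightarrow> int \<Rightarrow> bool" where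
  "arc s j \<longleftrightarrow> s \<in> S \<and> meets s (j + 4) \<and> meets s j \<and> meets s (j + 1)"

definition fork :: "'a \<Rightarrow> int \<Rightarrow> bool" where
  "fork s j \<longleftrightarrow> s \<in> S \<and> meets s j \<and> meets s (j + 2) \<and> meets s (j + 3)"

lemma meets_wrap: "meets s (j + 5) = meets s j" "meets s (j + 6) = meets s (j + 1)"
  "meets s (j + 7) = meets s (j + 2)" "meets s (j + 8) = meets s (j + 3)"
  by (simp_all add: meets_def V_wrap)

lemma meetsI: "x \<in> V i \<Longrightarrow> adj s x \<Longrightarrow> meets s i"
  unfolding meets_def by blast

lemma S_stable: "s \<in> S \<Longrightarrow> t \<in> S \<Longrightarrow> \<not> adj s t"
  using S_transversal unfolding triangle_transversal_def by blast

lemma not_meets_four: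
  "\<not> (meets s j \<and> meets s (j + 1) \<and> meets s (j + 2) \<and> meets s (j + 3))"
proof
  assume "meets s j \<and> meets s (j + 1) \<and> meets s (j + 2) \<and> meets s (j + 3)"
  then obtain x0 x1 x2 x3 where x: "x0 \<in> V j" "x1 \<in> V (j + 1)" "x2 \<in> V (j + 2)" "x3 \<in> V (j + 3)"
    "adj s x0" "adj s x1" "adj s x2" "adj s x3"
    unfolding meets_def by blast
  obtain x4 where "x4 \<in> V (j + 4)" using V_nonempty by blast
  then have "pentagon x0 x1 x2 x3 x4" using V_pentagon x by blast
  then show False using no_four_on_pentagon no_five_on_pentagon x by blast
qed

lemma arc_not_meets:
  assumes "arc s j"
  shows "\<not> meets s (j + 2)" "\<not> meets s (j + 3)"
  using not_meets_four[of s "j + 4"] not_meets_four[of s "j + 3"] assms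
  unfolding arc_def by (simp_all add: add.assoc meets_wrap)

lemma fork_not_meets:
  assumes "fork s j"
  shows "\<not> meets s (j + 1)" "\<not> meets s (j + 4)"
  using not_meets_four[of s j] not_meets_four[of s "j + 2"] assms
  unfolding fork_def by (simp_all add: add.assoc meets_wrap)

text \<open>Arcs and forks can miss vertices of a class that they meet, but not everywhere: if this left
  only two consecutive neighbours on some pentagon, there would be an induced \<open>P\<^sub>5\<close>.
  This is what allows representatives common to several vertices of \<open>S\<close> to be chosen.\<close>

lemma arc_full:
  assumes "arc s j"
  shows "x \<in> V (j + 1) \<Longrightarrow> adj s x" "x \<in> V (j + 4) \<Longrightarrow> adj s x"
proof -
  obtain x0 x1 x4 where x: "x0 \<in> V j" "x1 \<in> V (j + 1)" "x4 \<in> V (j + 4)"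
    "adj s x0" "adj s x1" "adj s x4"
    using assms unfolding meets_def arc_def by blast
  obtain x2 x3 where y: "x2 \<in> V (j + 2)" "x3 \<in> V (j + 3)" using V_nonempty by blast
  have n: "\<not> adj s x2" "\<not> adj s x3" using arc_not_meets[OF assms] y meetsI by blast+
  show "adj s x" if "x \<in> V (j + 1)"
    using V_pentagon[OF x(1) that y x(3)] pentagon_rotate pentagon_nbr_not_edge[of x4 x0 x x2 x3 s] n x by blast
  show "adj s x" if "x \<in> V (j + 4)"
    using V_pentagon[OF x(1,2) y that] pentagon_nbr_not_edge[of x0 x1 x2 x3 x s] n x by blast
qed

lemma fork_full:
  assumes "fork s j" "x \<in> V j"
  shows "adj s x"
proof -
  obtain x2 x3 where x: "x2 \<in> V (j + 2)" "x3 \<in> V (j + 3)" "adj s x2" "adj s x3"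
    using assms unfolding meets_def fork_def by blast
  obtain x1 x4 where y: "x1 \<in> V (j + 1)" "x4 \<in> V (j + 4)" using V_nonempty by blast
  have "\<not> adj s x1" "\<not> adj s x4" using fork_not_meets[OF assms(1)] y meetsI by blast+
  then show ?thesis
    using V_pentagon[OF assms(2) y(1) x(1,2) y(2)] pentagon_rotate pentagon_nbr_not_edge[of x2 x3 x4 x x1 s] x
    by blast
qed

text \<open>The path runs from \<open>t\<close> around the far side of the pentagon to \<open>s\<close>.\<close>

lemma no_arc_next:
  assumes "arc s j" "arc t (j + 1)"
  shows False
proof -
  obtain x2 where x2: "x2 \<in> V (j + 2)" "adj t x2"
    using assms(2) unfolding arc_def meets_def by (auto simp: add.assoc)
  obtain x4 where x4: "x4 \<in> V (j + 4)" "adj s x4"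
    using assms(1) unfolding arc_def meets_def by blast
  obtain x0 x1 x3 where x: "x0 \<in> V j" "x1 \<in> V (j + 1)" "x3 \<in> V (j + 3)" using V_nonempty by blast
  have p: "pentagon x0 x1 x2 x3 x4" using V_pentagon x x2 x4 by blast
  have "\<not> adj s x2" "\<not> adj s x3" using arc_not_meets[OF assms(1)] x2 x meetsI by blast+
  moreover have "\<not> adj t x3" "\<not> adj t x4"
    using arc_not_meets[OF assms(2)] x x4 meetsI by (auto simp: add.assoc)
  moreover have "\<not> adj s t" using assms S_stable unfolding arc_def by blast
  ultimately show False
    using no_P5[of t x2 x3 x4 s] p x2 x4 unfolding pentagon_def by (meson sym)
qed

lemma no_arc_second:
  assumes "arc s j" "arc t (j + 2)"
  shows False
proof -
  obtain x0 where x0: "x0 \<in> V j" "adj s x0" using assms(1) unfolding arc_def meets_def by blast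
  obtain x2 where x2: "x2 \<in> V (j + 2)" "adj t x2" using assms(2) unfolding arc_def meets_def by blast
  obtain x1 x3 x4 where x: "x1 \<in> V (j + 1)" "x3 \<in> V (j + 3)" "x4 \<in> V (j + 4)"
    using V_nonempty by blast
  have "adj s x1" "adj s x4" "adj t x1" "adj t x3"
    using arc_full[OF assms(1)] arc_full[OF assms(2)] x by (simp_all add: add.assoc V_wrap)
  then show False using no_moser_spindle[OF V_pentagon[OF x0(1) x(1) x2(1) x(2,3)]] x0 x2 by blast
qed

text \<open>Consecutive forks have the same neighbours in the class opposite to both. A neighbour \<open>x\<close> of
  only one of them would extend to an induced \<open>P\<^sub>5\<close> through both.\<close>

lemma fork_next_share:
  assumes D: "fork s j" "fork t (j + 1)" and x: "x \<in> V (j + 3)"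
  shows "adj s x \<longleftrightarrow> adj t x"
proof -
  obtain x1 x4 where t: "x1 \<in> V (j + 1)" "x4 \<in> V (j + 4)" "adj t x1" "adj t x4"
    using D(2) unfolding fork_def meets_def by (auto simp: add.assoc)
  obtain x0 x2 where s: "x0 \<in> V j" "x2 \<in> V (j + 2)" "adj s x0" "adj s x2"
    using D(1) unfolding fork_def meets_def by blast
  have p: "pentagon x0 x1 x2 x x4" using V_pentagon x s t by blast
  have "\<not> adj s x1" "\<not> adj s x4" using fork_not_meets[OF D(1)] t meetsI by blast+
  moreover have "\<not> adj t x0" "\<not> adj t x2"
    using fork_not_meets[OF D(2)] s meetsI by (auto simp: add.assoc V_wrap meets_wrap)
  moreover have "\<not> adj s t" using D S_stable unfolding fork_def by blast
  ultimately show ?thesis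
    using no_P5[of s x x4 t x1] no_P5[of t x x2 s x0] p s t unfolding pentagon_def by (meson sym)
qed

text \<open>The path is \<open>s x2 u x4 t\<close>: consecutive members have a common neighbour in the blow-up, and \<open>x4\<close>
  can be chosen common to \<open>u\<close> and \<open>t\<close> by the previous lemma.\<close>

lemma no_three_forks:
  assumes D: "fork s j" "fork t (j + 1)" "fork u (j + 2)"
  shows False
proof -
  obtain x2 where s: "x2 \<in> V (j + 2)" "adj s x2" using D(1) unfolding fork_def meets_def by blast
  obtain x4 where u: "x4 \<in> V (j + 4)" "adj u x4"
    using D(3) unfolding fork_def meets_def by (auto simp: add.assoc)
  have "adj t x4" using fork_next_share[of t "j + 1" u x4] D u by (simp add: add.assoc)
  moreover have "adj u x2" using fork_full[OF D(3)] s by blast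
  moreover have "\<not> adj s x4" using fork_not_meets[OF D(1)] u meetsI by blast
  moreover have "\<not> adj t x2" using fork_not_meets[OF D(2)] s meetsI by (auto simp: add.assoc)
  moreover have "\<not> adj x2 x4" using V_adj(2)[OF s(1)] u by (simp add: add.assoc)
  moreover have "\<not> adj s t" "\<not> adj s u" "\<not> adj u t" using D S_stable unfolding fork_def by blast+
  ultimately show False using no_P5[of s x2 u x4 t] s u sym by blast
qed

lemma no_arc_opposite_forks:
  assumes "arc b j" "fork s (j + 2)" "fork t (j + 3)"
  shows False
proof -
  obtain x4 where s: "x4 \<in> V (j + 4)" "adj s x4"
    using assms(2) unfolding fork_def meets_def by (auto simp: add.assoc)
  obtain x1 where t: "x1 \<in> V (j + 1)" "adj t x1"
    using assms(3) unfolding fork_def meets_def by (auto simp: add.assoc V_wrap)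
  have "adj b x4" "adj b x1" using arc_full[OF assms(1)] s t by blast+
  moreover have "\<not> adj s x1" using fork_not_meets[OF assms(2)] t meetsI
    by (auto simp: add.assoc meets_wrap)
  moreover have "\<not> adj t x4" using fork_not_meets[OF assms(3)] s meetsI by (auto simp: add.assoc)
  moreover have "\<not> adj x4 x1" using V_adj(3)[OF t(1)] s sym by (auto simp: add.assoc)
  moreover have "\<not> adj s b" "\<not> adj s t" "\<not> adj b t"
    using assms S_stable unfolding arc_def fork_def by blast+
  ultimately show False using no_P5[of s x4 b x1 t] s t sym by blast
qed

text \<open>Far vertices are those at distance at least two from the blow-up, outside \<open>S\<close>. Their
  neighbours in \<open>S\<close> that meet the blow-up are forks, because every other type continues to an induced
  path of three more vertices inside the blow-up.\<close>

definition far :: "'a \<Rightarrow> bool" where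
  "far w \<longleftrightarrow> w \<notin> S \<and> (\<forall>i. \<not> meets w i)"

lemma far_nonadj: "far w \<Longrightarrow> x \<in> V i \<Longrightarrow> \<not> adj w x"
  unfolding far_def meets_def by blast

lemma far_nbr_step:
  assumes "far w" "adj s w" "meets s k"
  shows "meets s (k + 1) \<or> meets s (k + 2)"
proof (rule ccontr)
  assume "\<not> ?thesis"
  moreover obtain x where x: "x \<in> V k" "adj s x" using assms(3) unfolding meets_def by blast
  moreover obtain y z where yz: "y \<in> V (k + 1)" "z \<in> V (k + 2)" using V_nonempty by blast
  ultimately have "\<not> adj s y" "\<not> adj s z" using meetsI by blast+
  moreover have "adj x y" "\<not> adj x z" using V_adj[OF x(1)] yz by blast+
  moreover have "adj y z" using V_adj(1)[OF yz(1)] yz by (simp add: add.assoc)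
  moreover have "\<not> adj w x" "\<not> adj w y" "\<not> adj w z" using far_nonadj[OF assms(1)] x yz by blast+
  ultimately show False using no_P5[of w s x y z] x assms(2) sym by blast
qed

text \<open>By the preceding step, consecutive classes that \<open>s\<close> meets are at most two apart. On a cycle of
  length five with at most three classes met, the gaps must be \<open>1\<close>, \<open>2\<close>, \<open>2\<close>.\<close>

lemma far_nbr_fork:
  assumes "far w" "adj s w" "meets s k" "s \<in> S"
  shows "\<exists>j. fork s j"
proof -
  have step: "meets s i \<Longrightarrow> meets s (i + 1) \<or> meets s (i + 2)" for i
    using far_nbr_step[OF assms(1,2)] .
  have four: "\<not> (meets s i \<and> meets s (i + 1) \<and> meets s (i + 2) \<and> meets s (i + 3))" for i
    by (rule not_meets_four)
  have "meets s k \<and> meets s (k + 2) \<and> meets s (k + 3) \<or>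
      meets s (k + 1) \<and> meets s (k + 3) \<and> meets s (k + 4) \<or>
      meets s (k + 2) \<and> meets s (k + 4) \<and> meets s k \<or>
      meets s (k + 3) \<and> meets s k \<and> meets s (k + 1) \<or>
      meets s (k + 4) \<and> meets s (k + 1) \<and> meets s (k + 2)"
    using step[of k] step[of "k + 1"] step[of "k + 2"] step[of "k + 3"] step[of "k + 4"]
      four[of k] four[of "k + 1"] four[of "k + 2"] four[of "k + 3"] four[of "k + 4"] assms(3)
    by (cases "meets s (k + 1)"; cases "meets s (k + 2)"; cases "meets s (k + 3)";
        simp add: add.assoc meets_wrap)
  then have "fork s k \<or> fork s (k + 1) \<or> fork s (k + 2) \<or> fork s (k + 3) \<or> fork s (k + 4)"
    using assms(4) unfolding fork_def by (simp add: add.assoc meets_wrap)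
  then show ?thesis by blast
qed

lemma far_arc_nonadj:
  assumes "far w" "arc b j"
  shows "\<not> adj b w"
  using far_nbr_step[OF assms(1), of b "j + 1"] arc_not_meets[OF assms(2)] assms(2)
  unfolding arc_def by (auto simp: add.assoc)

text \<open>Otherwise \<open>w d x y d'\<close> is an induced path, with \<open>x\<close> and \<open>y\<close> in consecutive classes.\<close>

lemma far_nbr_transfer:
  assumes w: "far w" "adj d w" and dS: "d \<in> S" "d' \<in> S"
    and m: "meets d a" "meets d' b" "\<not> meets d b" "\<not> meets d' a" and ab: "b = a + 1 \<or> a = b + 1"
  shows "adj d' w"
proof -
  obtain x y where xy: "x \<in> V a" "adj d x" "y \<in> V b" "adj d' y"
    using m unfolding meets_def by blast
  have "adj x y" using ab V_adj(1) xy sym by blast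
  moreover have "\<not> adj d y" "\<not> adj x d'" using m xy meetsI sym by blast+
  moreover have "\<not> adj w x" "\<not> adj w y" using far_nonadj w xy by blast+
  ultimately show ?thesis
    using no_P5[of w d x y d'] xy w S_stable dS sym by blast
qed

lemma far_no_arc:
  assumes "far w" "adj d w" "fork d j" "arc b j"
  shows False
  using far_nbr_transfer[OF assms(1,2), of b "j + 3" "j + 4"] far_arc_nonadj[OF assms(1,4)] assms(3,4)
    fork_not_meets[OF assms(3)] arc_not_meets[OF assms(4)]
  unfolding arc_def fork_def by (simp add: add.assoc)

lemma far_all_forks:
  assumes w: "far w" "adj d w" and d: "fork d j" and d': "fork d' (j + k)" and k: "k \<in> {1,2,3,4}"
  shows "adj d' w"
proof -
  consider "k = 1" | "k = 2" | "k = 3" | "k = 4" using k by blast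
  then show ?thesis
  proof cases
    case 1
    then show ?thesis
      using far_nbr_transfer[OF w, of d' "j + 2" "j + 1"] d d' fork_not_meets[OF d] fork_not_meets[OF d']
      unfolding fork_def by (simp add: add.assoc meets_wrap)
  next
    case 2
    then show ?thesis
      using far_nbr_transfer[OF w, of d' "j + 3" "j + 4"] d d' fork_not_meets[OF d] fork_not_meets[OF d']
      unfolding fork_def by (simp add: add.assoc meets_wrap)
  next
    case 3
    then show ?thesis
      using far_nbr_transfer[OF w, of d' "j + 2" "j + 1"] d d' fork_not_meets[OF d] fork_not_meets[OF d']
      unfolding fork_def by (simp add: add.assoc meets_wrap)
  next
    case 4
    then show ?thesis
      using far_nbr_transfer[OF w, of d' "j + 3" "j + 4"] d d' fork_not_meets[OF d] fork_not_meets[OF d']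
      unfolding fork_def by (simp add: add.assoc meets_wrap)
  qed
qed

text \<open>Otherwise \<open>y w d\<close> continues into \<open>V j\<close> and \<open>V (j + 1)\<close>. So a fork is
  adjacent to all or none of the vertices of a far component. As \<open>S\<close> is stable, the case \<open>y \<in> S\<close>
  shows that \<open>w\<close> has no neighbours in \<open>S\<close> away from the blow-up.\<close>

lemma far_path:
  assumes w: "far w" "adj d w" and d: "fork d j" and y: "adj w y" "\<forall>i. \<not> meets y i"
  shows "adj d y"
proof (rule ccontr)
  assume n: "\<not> adj d y"
  obtain x where x: "x \<in> V j" "adj d x" using d unfolding fork_def meets_def by blast
  obtain x' where x': "x' \<in> V (j + 1)" using V_nonempty by blast
  have "adj x x'" using V_adj x x' by blast
  moreover have "\<not> adj d x'" using fork_not_meets[OF d] x' meetsI by blast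
  moreover have "\<not> adj w x" "\<not> adj w x'" using far_nonadj w x x' by blast+
  moreover have "\<not> adj y x" "\<not> adj y x'" using y(2) x x' meetsI by blast+
  ultimately show False using no_P5[of y w d x x'] x y n w sym by blast
qed

definition holds_edge :: "int \<Rightarrow> bool" where
  "holds_edge j \<longleftrightarrow> (\<exists>d w w'. fork d j \<and> far w \<and> far w' \<and> adj w w' \<and> adj d w \<and> adj d w')"

text \<open>All forks at different indices share their far neighbours, so one fork attached to a far edge
  forces all others to be attached to the same edge.\<close>

lemma holds_edge_all:
  assumes "holds_edge j" "fork d' (j + k)" "k \<in> {1,2,3,4}"
  shows "holds_edge (j + k)"
  using assms far_all_forks unfolding holds_edge_def by meson

lemma holds_edge_not_next:
  assumes "holds_edge j" "holds_edge (j + 1)"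
  shows False
proof -
  obtain d w w' where d: "fork d j" "far w" "far w'" "adj w w'" "adj d w" "adj d w'"
    using assms(1) unfolding holds_edge_def by blast
  obtain d' where d': "fork d' (j + 1)" using assms(2) unfolding holds_edge_def by blast
  have w: "adj d' w" "adj d' w'" using far_all_forks[of _ d j d' 1] d d' by auto
  obtain x0 x2 x3 where x: "x0 \<in> V j" "x2 \<in> V (j + 2)" "x3 \<in> V (j + 3)"
    "adj d x0" "adj d x2" "adj d x3"
    using d unfolding fork_def meets_def by blast
  obtain x1 x4 where y: "x1 \<in> V (j + 1)" "x4 \<in> V (j + 4)" "adj d' x1" "adj d' x4"
    using d' unfolding fork_def meets_def by (auto simp: add.assoc)
  have "adj d' x3" using fork_next_share d d' x by blast
  then show False using no_next_forks_on_edge[OF V_pentagon[OF x(1) y(1) x(2,3) y(2)]] x y d w by blast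
qed

lemma holds_edge_no_arc_between:
  assumes "holds_edge j" "holds_edge (j + 2)" "arc b (j + 1)"
  shows False
proof -
  obtain d w w' where d: "fork d j" "far w" "far w'" "adj w w'" "adj d w" "adj d w'"
    using assms(1) unfolding holds_edge_def by blast
  obtain d' where d': "fork d' (j + 2)" using assms(2) unfolding holds_edge_def by blast
  have w: "adj d' w" "adj d' w'" using far_all_forks[of _ d j d' 2] d d' by auto
  obtain x2 x3 where x: "x2 \<in> V (j + 2)" "x3 \<in> V (j + 3)" "adj d x2" "adj d x3"
    using d unfolding fork_def meets_def by blast
  obtain x4 x0 where y: "x4 \<in> V (j + 4)" "x0 \<in> V j" "adj d' x4" "adj d' x0"
    using d' unfolding fork_def meets_def by (auto simp: add.assoc V_wrap)
  obtain x1 where x1: "x1 \<in> V (j + 1)" "adj b x1" using assms(3) unfolding arc_def meets_def by blast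
  have "adj d x0" "adj d' x2" using fork_full d d' x y by blast+
  moreover have "adj b x0" "adj b x2" using arc_full[OF assms(3)] x y by (simp_all add: add.assoc V_wrap)
  ultimately show False using no_second_forks_on_edge_with_arc[OF V_pentagon[OF y(2) x1(1) x(1,2) y(1)]] x x1 y d w by blast
qed

end

section \<open>Colouring a blow-up with its surroundings\<close>

text \<open>\<open>B\<close>, \<open>D\<close> and \<open>E\<close> mark the indices of arcs, of forks, and of forks attached to a far edge. At most
  one index carries arcs. If \<open>E j\<close> holds, then \<open>E\<close> marks all other indices of forks, and there is at most
  one of them, at distance two from \<open>j\<close>; one of \<open>j + 1\<close> and \<open>j + 4\<close> works. If no index is marked by \<open>E\<close>, an
  index opposite to the arcs works, or without arcs any index without forks.\<close>

lemma pentagon_index_exists: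
  fixes B D E :: "int \<Rightarrow> bool"
  assumes per: "\<And>j. B (j + 5) = B j" "\<And>j. D (j + 5) = D j" "\<And>j. E (j + 5) = E j"
    and BB: "\<And>j. \<not> (B j \<and> B (j + 1))" "\<And>j. \<not> (B j \<and> B (j + 2))"
    and DDD: "\<And>j. \<not> (D j \<and> D (j + 1) \<and> D (j + 2))"
    and BDD: "\<And>j. \<not> (B j \<and> D (j + 2) \<and> D (j + 3))"
    and E: "\<And>j. E j \<Longrightarrow> D j" "\<And>j. \<not> (E j \<and> B j)" "\<And>j. \<not> (E j \<and> E (j + 1))"
      "\<And>j k. E j \<Longrightarrow> D (j + k) \<Longrightarrow> k \<in> {1,2,3,4} \<Longrightarrow> E (j + k)"
      "\<And>j. \<not> (E j \<and> E (j + 2) \<and> B (j + 1))"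
  shows "\<exists>j. \<not> D j \<and> \<not> B (j + 4) \<and> \<not> B j \<and> \<not> B (j + 1) \<and> \<not> E (j + 2) \<and> \<not> E (j + 3)"
proof -
  have per': "P (j + 6) = P (j + 1)" "P (j + 7) = P (j + 2)" "P (j + 8) = P (j + 3)"
    if "\<And>j. P (j + 5) = P j" for P :: "int \<Rightarrow> bool" and j
    using that[of "j + 1"] that[of "j + 2"] that[of "j + 3"] by (simp_all add: add.assoc)
  note per = per per'[of B, OF per(1)] per'[of D, OF per(2)] per'[of E, OF per(3)]
  show ?thesis
  proof (cases "\<exists>j. E j")
    case True
    then obtain j where j: "E j" by blast
    have D: "D (j + k) \<longleftrightarrow> E (j + k)" if "k \<in> {1,2,3,4}" for k
      using E(1,4) j that by blast
    have n: "\<not> E (j + 1)" "\<not> E (j + 4)" "\<not> B j" "\<not> (E (j + 2) \<and> E (j + 3))"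
      "\<not> (E (j + 2) \<and> B (j + 1))" "\<not> (E (j + 3) \<and> B (j + 4))"
      using E(3)[of j] E(3)[of "j + 4"] E(2)[of j] E(3)[of "j + 2"] E(5)[of j] E(5)[of "j + 3"] j
      by (simp_all add: add.assoc per)
    have m: "\<not> (E (j + 2) \<and> B (j + 2))" "\<not> (E (j + 3) \<and> B (j + 3))"
      using E(2) by blast+
    have b12: "\<not> (B (j + 1) \<and> B (j + 2))"
      using BB(1)[of "j + 1"] by (simp add: add.assoc per)
    have b23: "\<not> (B (j + 2) \<and> B (j + 3))"
      using BB(1)[of "j + 2"] by (simp add: add.assoc per)
    have b34: "\<not> (B (j + 3) \<and> B (j + 4))"
      using BB(1)[of "j + 3"] by (simp add: add.assoc per)
    have b41: "\<not> (B (j + 4) \<and> B (j + 1))"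
      using BB(2)[of "j + 4"] by (simp add: add.assoc per)
    have b13: "\<not> (B (j + 1) \<and> B (j + 3))"
      using BB(2)[of "j + 1"] by (simp add: add.assoc per)
    have b24: "\<not> (B (j + 2) \<and> B (j + 4))"
      using BB(2)[of "j + 2"] by (simp add: add.assoc per)
    note b = b12 b23 b34 b41 b13 b24
    show ?thesis
    proof (cases "E (j + 2) \<or> B (j + 3) \<or> B (j + 4)")
      case False
      then have "\<not> D (j + 4) \<and> \<not> B (j + 3) \<and> \<not> B (j + 4) \<and> \<not> B j \<and> \<not> E (j + 1) \<and> \<not> E (j + 2)"
        using n D[of 4] by blast
      then show ?thesis by (intro exI[of _ "j + 4"]) (simp add: add.assoc per)
    next
      case True
      then have "\<not> D (j + 1) \<and> \<not> B j \<and> \<not> B (j + 1) \<and> \<not> B (j + 2) \<and> \<not> E (j + 3) \<and> \<not> E (j + 4)"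
        using n m b D[of 1] by blast
      then show ?thesis by (intro exI[of _ "j + 1"]) (simp add: add.assoc per)
    qed
  next
    case noE: False
    show ?thesis
    proof (cases "\<exists>j. B j")
      case True
      then obtain j where j: "B j" by blast
      have b: "\<not> B (j + 1)" "\<not> B (j + 2)" "\<not> B (j + 3)" "\<not> B (j + 4)"
        using BB(1)[of j] BB(2)[of j] BB(2)[of "j + 3"] BB(1)[of "j + 4"] j
        by (simp_all add: add.assoc per)
      show ?thesis
      proof (cases "D (j + 2)")
        case False
        then show ?thesis using b noE by (intro exI[of _ "j + 2"]) (simp add: add.assoc per)
      next
        case True
        then have "\<not> D (j + 3)" using BDD j by blast
        then show ?thesis using b noE by (intro exI[of _ "j + 3"]) (simp add: add.assoc per)
      qed
    next
      case False
      obtain j where "\<not> D j" using DDD by blast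
      then show ?thesis using False noE by blast
    qed
  qed
qed

context pentagon_blowup begin

lemma V_disjoint:
  assumes "x \<in> V j"
  shows "x \<notin> V (j + 1)" "x \<notin> V (j + 2)" "x \<notin> V (j + 3)" "x \<notin> V (j + 4)"
proof -
  show "x \<notin> V (j + 1)" using V_adj(1)[OF assms] irrefl by blast
  show "x \<notin> V (j + 4)" using V_adj(4)[OF assms] irrefl by blast
  show "x \<notin> V (j + 2)"
  proof
    assume x: "x \<in> V (j + 2)"
    obtain y where "y \<in> V (j + 3)" using V_nonempty by blast
    then show False using V_adj(3)[OF assms] V_adj(1)[OF x] by (simp add: add.assoc)
  qed
  show "x \<notin> V (j + 3)"
  proof
    assume x: "x \<in> V (j + 3)"
    obtain y where "y \<in> V (j + 4)" using V_nonempty by blast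
    then show False using V_adj(4)[OF assms] V_adj(1)[OF x] V_adj(4)[OF assms]
      using V_nonempty[of "j + 2"] V_adj(2)[OF assms] V_adj(4)[OF x] by (auto simp: add.assoc V_wrap)
  qed
qed

text \<open>The bags, the vertices of \<open>S\<close> touching them, and the far vertices attached to the latter (the
  fringe) form a closed set.\<close>

definition bags :: "'a set" where
  "bags = (\<Union>i. V i)"

definition touching :: "'a set" where
  "touching = {s \<in> S. \<exists>k. meets s k}"

definition fringe :: "'a set" where
  "fringe = {w. far w \<and> (\<exists>s\<in>touching. adj s w)}"

lemma fringe_nbr_fork:
  assumes "w \<in> fringe" "adj w s" "s \<in> S"
  shows "\<exists>j. fork s j"
proof -
  obtain d where d: "d \<in> touching" "adj d w" and w: "far w" using assms(1) unfolding fringe_def by blast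
  obtain j where j: "fork d j" using far_nbr_fork[OF w] d unfolding touching_def by blast
  have "\<exists>i. meets s i"
  proof (rule ccontr)
    assume "\<not> ?thesis"
    then have "adj d s" using far_path[OF w d(2) j assms(2)] by blast
    then show False using S_stable d(1) assms(3) unfolding touching_def by blast
  qed
  then show ?thesis using far_nbr_fork[OF w] assms sym by blast
qed

lemma fringe_closed:
  assumes "w \<in> fringe" "adj w y" "y \<notin> S"
  shows "y \<in> fringe" "s \<in> S \<Longrightarrow> adj w s \<Longrightarrow> adj s y"
proof -
  have w: "far w" using assms(1) unfolding fringe_def by blast
  have y: "\<forall>i. \<not> meets y i"
  proof (rule ccontr)
    assume "\<not> ?thesis"
    then obtain x i where x: "x \<in> V i" "adj y x" unfolding meets_def by blast
    then obtain k where "y \<in> V k" using V_closed[OF x(1)] assms(3) sym by blast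
    then show False using far_nonadj[OF w] assms(2) by blast
  qed
  have n: "adj s y" if s: "s \<in> S" "adj w s" for s
  proof -
    obtain j where "fork s j" using fringe_nbr_fork[OF assms(1) s(2,1)] by blast
    then show ?thesis using far_path[OF w _ _ assms(2) y] s sym by blast
  qed
  then show "s \<in> S \<Longrightarrow> adj w s \<Longrightarrow> adj s y" .
  obtain d where "d \<in> touching" "adj d w" using assms(1) unfolding fringe_def by blast
  then show "y \<in> fringe" using n y assms(3) sym unfolding fringe_def far_def touching_def by blast
qed

lemma closed_neighbourhood:
  "closed_in UNIV (bags \<union> touching \<union> fringe)"
proof -
  have "y \<in> bags \<union> touching \<union> fringe" if x: "x \<in> bags \<union> touching \<union> fringe" and xy: "adj x y" for x y
  proof -
    consider (bags) "x \<in> bags" | (touch) "x \<in> touching" | (fringe) "x \<in> fringe" using x by blast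
    then show ?thesis
    proof cases
      case bags
      then obtain i where xi: "x \<in> V i" unfolding bags_def by blast
      show ?thesis
      proof (cases "y \<in> S")
        case True
        then have "y \<in> touching"
          using meetsI[OF xi] xy sym unfolding touching_def by blast
        then show ?thesis by blast
      next
        case False
        then show ?thesis using V_closed[OF xi xy] unfolding bags_def by blast
      qed
    next
      case touch
      then have yS: "y \<notin> S" using S_stable xy unfolding touching_def by blast
      show ?thesis
      proof (cases "\<exists>i. meets y i")
        case True
        then obtain i z where "z \<in> V i" "adj y z" unfolding meets_def by blast
        then show ?thesis using V_closed[of z i y] yS sym unfolding bags_def by blast
      next
        case False
        then show ?thesis using touch yS xy unfolding fringe_def far_def by blast
      qed
    next
      case fringe
      show ?thesis
      proof (cases "y \<in> S")
        case True
        then obtain j where "fork y j" using fringe_nbr_fork[OF fringe xy] by blast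
        then show ?thesis using True unfolding fork_def touching_def by blast
      next
        case False
        then show ?thesis using fringe_closed fringe xy by blast
      qed
    qed
  qed
  then show ?thesis unfolding closed_in_def by blast
qed

lemma no_triangle_outside: "\<lbrakk>a \<notin> S; b \<notin> S; c \<notin> S; adj a b; adj b c; adj a c\<rbrakk> \<Longrightarrow> False"
  using S_transversal unfolding triangle_transversal_def by blast

text \<open>A pentagon in the fringe would be complete to some vertex of \<open>S\<close>.\<close>

lemma fringe_two_colourable: "colourable_on 2 fringe"
proof (rule two_colourable_if_no_short_odd_cycle)
  show False if "a \<in> fringe" "b \<in> fringe" "c \<in> fringe" "adj a b" "adj b c" "adj a c" for a b c
    using that no_triangle_outside unfolding fringe_def far_def by blast
  show False if p: "pentagon a b c d e" and m: "a \<in> fringe" "b \<in> fringe" "c \<in> fringe" "d \<in> fringe" "e \<in> fringe"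
    for a b c d e
  proof -
    obtain s where s: "s \<in> S" "adj s a" using m(1) unfolding fringe_def touching_def by blast
    have out: "a \<notin> S" "b \<notin> S" "c \<notin> S" "d \<notin> S" "e \<notin> S" using m unfolding fringe_def far_def by blast+
    have sb: "adj s b" using fringe_closed(2)[OF m(1), of b s] s p out sym unfolding pentagon_def by blast
    have sc: "adj s c" using fringe_closed(2)[OF m(2), of c s] s sb p out sym unfolding pentagon_def by blast
    have sd: "adj s d" using fringe_closed(2)[OF m(3), of d s] s sc p out sym unfolding pentagon_def by blast
    have "adj s e" using fringe_closed(2)[OF m(4), of e s] s sd p out sym unfolding pentagon_def by blast
    then show False using no_five_on_pentagon[OF p s(2) sb sc sd] by blast
  qed
qed

lemma good_index:
  "\<exists>j. (\<nexists>s. fork s j) \<and> (\<nexists>s. arc s (j + 4)) \<and> (\<nexists>s. arc s j) \<and> (\<nexists>s. arc s (j + 1)) \<and>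
     \<not> holds_edge (j + 2) \<and> \<not> holds_edge (j + 3)"
proof (rule pentagon_index_exists)
  show "(\<exists>s. arc s (j + 5)) = (\<exists>s. arc s j)" "(\<exists>s. fork s (j + 5)) = (\<exists>s. fork s j)" for j
    unfolding arc_def fork_def
    using meets_wrap(4)[of _ "j + 1"] by (simp_all add: add.assoc add.commute[of 5] meets_wrap)
  show "holds_edge (j + 5) = holds_edge j" for j
    unfolding holds_edge_def fork_def by (simp add: add.assoc meets_wrap)
  show "\<not> ((\<exists>s. arc s j) \<and> (\<exists>s. arc s (j + 1)))" "\<not> ((\<exists>s. arc s j) \<and> (\<exists>s. arc s (j + 2)))" for j
    using no_arc_next no_arc_second by blast+
  show "\<not> ((\<exists>s. fork s j) \<and> (\<exists>s. fork s (j + 1)) \<and> (\<exists>s. fork s (j + 2)))" for j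
    using no_three_forks by blast
  show "\<not> ((\<exists>s. arc s j) \<and> (\<exists>s. fork s (j + 2)) \<and> (\<exists>s. fork s (j + 3)))" for j
    using no_arc_opposite_forks by blast
  show "\<exists>s. fork s j" if "holds_edge j" for j using that unfolding holds_edge_def by blast
  show "\<not> (holds_edge j \<and> (\<exists>s. arc s j))" for j
    using far_no_arc unfolding holds_edge_def by blast
  show "\<not> (holds_edge j \<and> holds_edge (j + 1))" for j using holds_edge_not_next by blast
  show "holds_edge (j + k)" if "holds_edge j" "\<exists>s. fork s (j + k)" "k \<in> {1,2,3,4}" for j k
    using holds_edge_all that by blast
  show "\<not> (holds_edge j \<and> holds_edge (j + 2) \<and> (\<exists>s. arc s (j + 1)))" for j
    using holds_edge_no_arc_between by blast
qed

lemma V_shift_multiple: "V (j + 5 * n) = V j"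
proof (induction n rule: int_induct[where k = 0])
  case (step1 i)
  have "j + 5 * (i + 1) = (j + 5 * i) + 5" by simp
  then show ?case using step1 V_wrap(1) by metis
next
  case (step2 i)
  have "j + 5 * i = (j + 5 * (i - 1)) + 5" by simp
  then show ?case using step2 V_wrap(1) by metis
qed simp

lemma V_exhaust:
  assumes "x \<in> V i"
  shows "x \<in> V j \<or> x \<in> V (j + 1) \<or> x \<in> V (j + 2) \<or> x \<in> V (j + 3) \<or> x \<in> V (j + 4)"
proof -
  have "i = (j + (i - j) mod 5) + 5 * ((i - j) div 5)" by simp
  then have "x \<in> V (j + (i - j) mod 5)" using assms V_shift_multiple by metis
  moreover have "(i - j) mod 5 \<in> {0, 1, 2, 3, 4}" by auto
  ultimately show ?thesis by auto
qed

lemma fork_exhaust: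
  assumes "fork s i"
  shows "fork s j \<or> fork s (j + 1) \<or> fork s (j + 2) \<or> fork s (j + 3) \<or> fork s (j + 4)"
proof -
  have i: "i = (j + (i - j) mod 5) + 5 * ((i - j) div 5)" by simp
  have "fork s (k + 5 * n) = fork s k" for k n
  proof -
    have "k + 5 * n + 2 = (k + 2) + 5 * n" "k + 5 * n + 3 = (k + 3) + 5 * n" by simp_all
    then show ?thesis unfolding fork_def meets_def by (simp only: V_shift_multiple)
  qed
  then have "fork s (j + (i - j) mod 5)" using assms i by metis
  moreover have "(i - j) mod 5 \<in> {0, 1, 2, 3, 4}" by auto
  ultimately show ?thesis by auto
qed

text \<open>Among the classes, only \<open>V j\<close> gets colour \<open>2\<close>. The absence of arcs near \<open>j\<close> and of
  forks at \<open>j\<close> makes the colour \<open>cS\<close> proper on \<open>S\<close>. Vertices of the fringe with a neighbour in the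
  fringe take the colours \<open>0\<close> and \<open>1\<close> of a bipartition, since the forks attached to them
  are at \<open>j + 1\<close> or \<open>j + 4\<close> and have colour \<open>2\<close>. The other ones only have forks as neighbours; if these
  had all three colours, there would be forks at three consecutive indices.\<close>

lemma neighbourhood_three_colourable: "colourable_on 3 (bags \<union> touching \<union> fringe)"
proof -
  obtain j where noD: "\<And>s. \<not> fork s j"
    and noB: "\<And>s. \<not> arc s (j + 4)" "\<And>s. \<not> arc s j" "\<And>s. \<not> arc s (j + 1)"
    and no_edge: "\<not> holds_edge (j + 2)" "\<not> holds_edge (j + 3)"
    using good_index by blast
  obtain g where g: "\<And>v. v \<in> fringe \<Longrightarrow> g v < (2::nat)"
    "\<And>u v. u \<in> fringe \<Longrightarrow> v \<in> fringe \<Longrightarrow> adj u v \<Longrightarrow> g u \<noteq> g v"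
    using fringe_two_colourable unfolding colourable_on_def by blast
  define cS :: "'a \<Rightarrow> nat" where
    "cS s = (if \<not> meets s j then 2 else if \<not> meets s (j + 1) \<and> \<not> meets s (j + 3) then 0 else 1)" for s
  define cV :: "'a \<Rightarrow> nat" where
    "cV x = (if x \<in> V j then 2 else if x \<in> V (j + 1) \<or> x \<in> V (j + 3) then 0 else 1)" for x
  define free where "free w k \<longleftrightarrow> k < 3 \<and> (\<forall>s\<in>S. adj w s \<longrightarrow> cS s \<noteq> k)" for w and k :: nat
  define cY where "cY w = (if \<exists>z\<in>fringe. adj w z then g w else SOME k. free w k)" for w
  define c where "c v = (if v \<in> S then cS v else if v \<in> bags then cV v else cY v)" for v
  have cS_one: "\<not> meets s (j + 2) \<and> \<not> meets s (j + 4)" if "cS s = 1" "s \<in> S" for s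
    using that noD[of s] noB[of s] unfolding cS_def fork_def arc_def
    by (auto simp: add.assoc meets_wrap split: if_splits)
  have SV: "cS s \<noteq> cV x" if s: "s \<in> S" and x: "x \<in> bags" and sx: "adj s x" for s x
  proof -
    obtain i where "x \<in> V i" using x unfolding bags_def by blast
    then consider "x \<in> V j" | "x \<in> V (j + 1) \<or> x \<in> V (j + 3)" | "x \<in> V (j + 2) \<or> x \<in> V (j + 4)"
      using V_exhaust[of x i j] by blast
    then show ?thesis
    proof cases
      case 1
      then have "meets s j" using meetsI sx by blast
      then show ?thesis using 1 unfolding cS_def cV_def by simp
    next
      case 2
      then have "x \<notin> V j" using V_disjoint by blast
      moreover have "meets s (j + 1) \<or> meets s (j + 3)" using 2 meetsI sx by blast
      ultimately show ?thesis using 2 unfolding cS_def cV_def by auto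
    next
      case 3
      have "meets s (j + 2) \<or> meets s (j + 4)" using 3 meetsI sx by blast
      then have "cS s \<noteq> 1" using cS_one s by blast
      moreover have "x \<notin> V j" using 3 V_disjoint by blast
      moreover have "x \<notin> V (j + 1) \<and> x \<notin> V (j + 3)"
        using 3 V_disjoint[of x "j + 1"] V_disjoint[of x "j + 3"] V_wrap[of j]
        by (auto simp: add.assoc)
      ultimately show ?thesis unfolding cV_def by auto
    qed
  qed
  have VV: "cV x \<noteq> cV y" if xy: "x \<in> bags" "y \<in> bags" "adj x y" for x y
  proof
    assume eq: "cV x = cV y"
    have in_class: "z \<in> V j \<and> cV z = 2 \<or> z \<in> V (j + 1) \<union> V (j + 3) \<and> cV z = 0 \<or>
        z \<in> V (j + 2) \<union> V (j + 4) \<and> cV z = 1" if z: "z \<in> bags" for z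
    proof -
      obtain i where "z \<in> V i" using z unfolding bags_def by blast
      then show ?thesis using V_exhaust[of z i j] unfolding cV_def by auto
    qed
    have stable2: "\<not> adj u v" if "u \<in> V i \<union> V (i + 2)" "v \<in> V i \<union> V (i + 2)" for u v i
      using that V_stable V_adj(2) sym by blast
    have "\<not> adj x y" if "x \<in> V j" "y \<in> V j" using that V_stable by blast
    moreover have "\<not> adj x y" if "x \<in> V (j + 1) \<union> V (j + 3)" "y \<in> V (j + 1) \<union> V (j + 3)"
      using that stable2[of x "j + 1" y] by (simp add: add.assoc)
    moreover have "\<not> adj x y" if "x \<in> V (j + 2) \<union> V (j + 4)" "y \<in> V (j + 2) \<union> V (j + 4)"
      using that stable2[of x "j + 2" y] by (simp add: add.assoc)
    ultimately show False using in_class[OF xy(1)] in_class[OF xy(2)] eq xy(3) by auto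
  qed
  have cS_D: "fork s (j + 1) \<and> cS s = 2 \<or> fork s (j + 2) \<and> cS s = 0 \<or>
      fork s (j + 3) \<and> cS s = 1 \<or> fork s (j + 4) \<and> cS s = 2" if D: "fork s i" for s i
  proof -
    consider "fork s (j + 1)" | "fork s (j + 2)" | "fork s (j + 3)" | "fork s (j + 4)"
      using fork_exhaust[OF D, of j] noD by blast
    then show ?thesis
    proof cases
      case 1
      then show ?thesis using fork_not_meets(2)[OF 1] unfolding cS_def by (simp add: add.assoc meets_wrap)
    next
      case 2
      then show ?thesis using fork_not_meets[OF 2] unfolding cS_def fork_def
        by (simp add: add.assoc meets_wrap)
    next
      case 3
      then show ?thesis unfolding cS_def fork_def by (simp add: add.assoc meets_wrap)
    next
      case 4
      then show ?thesis using fork_not_meets(1)[OF 4] unfolding cS_def by (simp add: add.assoc meets_wrap)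
    qed
  qed
  have free_ex: "\<exists>k. free w k" if w: "w \<in> fringe" for w
  proof (rule ccontr)
    assume "\<not> ?thesis"
    then have "\<not> free w 0" "\<not> free w 1" "\<not> free w 2" by blast+
    then obtain s0 s1 s2 where s: "s0 \<in> S" "adj w s0" "cS s0 = 0" "s1 \<in> S" "adj w s1" "cS s1 = 1"
      "s2 \<in> S" "adj w s2" "cS s2 = 2"
      unfolding free_def by auto
    then obtain i0 i1 i2 where "fork s0 i0" "fork s1 i1" "fork s2 i2"
      using fringe_nbr_fork[OF w] by meson
    then have "fork s0 (j + 2)" "fork s1 (j + 3)" "fork s2 (j + 1) \<or> fork s2 (j + 4)"
      using cS_D s(3,6,9) by (metis numeral_eq_one_iff zero_neq_numeral zero_neq_one semiring_norm(85))+
    then show False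
      using no_three_forks[of s2 "j + 1" s0 s1] no_three_forks[of s0 "j + 2" s1 s2] by (auto simp: add.assoc)
  qed
  have YS: "cY w \<noteq> cS s" if w: "w \<in> fringe" and s: "s \<in> S" "adj w s" for w s
  proof (cases "\<exists>z\<in>fringe. adj w z")
    case True
    then obtain z where z: "z \<in> fringe" "adj w z" by blast
    then have zw: "far w" "far z" "adj s w" "adj s z"
      using w s fringe_closed(2)[OF w z(2) _ s] sym unfolding fringe_def far_def by blast+
    obtain i where i: "fork s i" using fringe_nbr_fork w s by blast
    have "\<not> fork s (j + 2)" "\<not> fork s (j + 3)"
      using no_edge zw z(2) unfolding holds_edge_def by blast+
    then have "cS s = 2" using cS_D[OF i] by blast
    then show ?thesis using g(1)[OF w] True unfolding cY_def by simp
  next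
    case False
    then have "free w (cY w)" using someI_ex[OF free_ex[OF w]] unfolding cY_def by simp
    then show ?thesis using s unfolding free_def by auto
  qed
  have VY: "\<not> adj x w" if "x \<in> bags" "w \<in> fringe" for x w
    using that far_nonadj sym unfolding bags_def fringe_def by blast
  have YY: "cY u \<noteq> cY w" if "u \<in> fringe" "w \<in> fringe" "adj u w" for u w
    using that g(2) sym unfolding cY_def by auto
  have dis: "x \<notin> S" if "x \<in> bags" for x using that VS unfolding bags_def by blast
  have disY: "x \<notin> S \<and> x \<notin> bags" if "x \<in> fringe" for x
  proof -
    have "x \<notin> V i" for i
    proof
      assume x: "x \<in> V i"
      obtain y where "y \<in> V (i + 1)" using V_nonempty by blast
      then show False using V_adj(1)[OF x] far_nonadj that unfolding fringe_def by blast
    qed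
    then show ?thesis using that unfolding fringe_def far_def bags_def by blast
  qed
  have "c v < 3" if "v \<in> bags \<union> touching \<union> fringe" for v
  proof -
    have "cY v < 3" if v: "v \<in> fringe"
      using g(1)[OF v] someI_ex[OF free_ex[OF v]] unfolding cY_def free_def by simp
    then show ?thesis using that unfolding c_def cS_def cV_def touching_def by auto
  qed
  moreover have "c u \<noteq> c v" if "u \<in> bags \<union> touching \<union> fringe" "v \<in> bags \<union> touching \<union> fringe" "adj u v" for u v
  proof -
    have c_cases: "z \<in> S \<and> c z = cS z \<or> z \<in> bags \<and> c z = cV z \<or> z \<in> fringe \<and> c z = cY z"
      if "z \<in> bags \<union> touching \<union> fringe" for z
      using that dis disY unfolding c_def touching_def by auto
    have "\<not> (u \<in> S \<and> v \<in> S)" using S_stable that(3) by blast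
    then show ?thesis
      using c_cases[OF that(1)] c_cases[OF that(2)] that(3) sym[OF that(3)]
        SV[of u v] SV[of v u] VV[of u v] VY[of u v] VY[of v u] YS[of u v] YS[of v u] YY[of u v]
      by auto
  qed
  ultimately show ?thesis unfolding colourable_on_def by blast
qed

end

context majority_P5_free begin

section \<open>Colouring the whole graph\<close>

text \<open>The class \<open>V i\<close> consists of the vertices that can replace the \<open>i\<close>-th vertex of the pentagon.
  Outside \<open>S\<close> there are no triangles, so the nonempty neighbourhoods on a pentagon are pairs at distance
  two; this gives closedness, applied to the original pentagon and to the one with \<open>x\<close> exchanged.\<close>

lemma pentagon_blowup_exists:
  assumes S: "triangle_transversal adj S" and p: "pentagon a b c d e"
    and out: "a \<notin> S" "b \<notin> S" "c \<notin> S" "d \<notin> S" "e \<notin> S"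
  shows "\<exists>V. pentagon_blowup adj S V \<and> a \<in> V 0"
proof -
  define q where "q i = (if i mod 5 = 0 then a else if i mod 5 = 1 then b else if i mod 5 = 2 then c
    else if i mod 5 = 3 then d else e)" for i :: int
  define V where "V i = {v. v \<notin> S \<and> adj v (q (i + 4)) \<and> adj v (q (i + 1))}" for i
  have q_wrap: "q (i + 5) = q i" "q (i + 6) = q (i + 1)" "q (i + 7) = q (i + 2)" "q (i + 8) = q (i + 3)" for i
  proof -
    have w: "q (i + 5) = q i" for i unfolding q_def by simp
    show "q (i + 5) = q i" "q (i + 6) = q (i + 1)" "q (i + 7) = q (i + 2)" "q (i + 8) = q (i + 3)"
      using w[of i] w[of "i + 1"] w[of "i + 2"] w[of "i + 3"] by (simp_all add: add.assoc)
  qed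
  have q_out: "q i \<notin> S" for i using out unfolding q_def by simp
  have pent_q: "pentagon (q i) (q (i + 1)) (q (i + 2)) (q (i + 3)) (q (i + 4))" for i
  proof -
    have r: "pentagon b c d e a" "pentagon c d e a b" "pentagon d e a b c" "pentagon e a b c d"
      using p pentagon_rotate by blast+
    have "i mod 5 = 0 \<or> i mod 5 = 1 \<or> i mod 5 = 2 \<or> i mod 5 = 3 \<or> i mod 5 = 4" by presburger
    then show ?thesis
    proof (elim disjE)
      assume i: "i mod 5 = 0"
      then have "(i + 1) mod 5 = 1" "(i + 2) mod 5 = 2" "(i + 3) mod 5 = 3" "(i + 4) mod 5 = 4" by presburger+
      then show ?thesis using p i unfolding q_def by simp
    next
      assume i: "i mod 5 = 1"
      then have "(i + 1) mod 5 = 2" "(i + 2) mod 5 = 3" "(i + 3) mod 5 = 4" "(i + 4) mod 5 = 0" by presburger+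
      then show ?thesis using r i unfolding q_def by simp
    next
      assume i: "i mod 5 = 2"
      then have "(i + 1) mod 5 = 3" "(i + 2) mod 5 = 4" "(i + 3) mod 5 = 0" "(i + 4) mod 5 = 1" by presburger+
      then show ?thesis using r i unfolding q_def by simp
    next
      assume i: "i mod 5 = 3"
      then have "(i + 1) mod 5 = 4" "(i + 2) mod 5 = 0" "(i + 3) mod 5 = 1" "(i + 4) mod 5 = 2" by presburger+
      then show ?thesis using r i unfolding q_def by simp
    next
      assume i: "i mod 5 = 4"
      then have "(i + 1) mod 5 = 0" "(i + 2) mod 5 = 1" "(i + 3) mod 5 = 2" "(i + 4) mod 5 = 3" by presburger+
      then show ?thesis using r i unfolding q_def by simp
    qed
  qed
  have tri: "\<lbrakk>x \<notin> S; y \<notin> S; z \<notin> S; adj x y; adj y z; adj x z\<rbrakk> \<Longrightarrow> False" for x y z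
    using S unfolding triangle_transversal_def by blast
  have Vq: "x \<notin> S" "adj x (q (i + 4))" "adj x (q (i + 1))" "\<not> adj x (q (i + 2))" "\<not> adj x (q (i + 3))"
    if x: "x \<in> V i" for x i
  proof -
    show 1: "x \<notin> S" "adj x (q (i + 4))" "adj x (q (i + 1))" using x unfolding V_def by auto
    show "\<not> adj x (q (i + 2))" "\<not> adj x (q (i + 3))"
      using tri[of x "q (i + 1)" "q (i + 2)"] tri[of x "q (i + 4)" "q (i + 3)"] 1 q_out pent_q[of i] sym
      unfolding pentagon_def by blast+
  qed
  have "blowup V"
    unfolding blowup_def
  proof (intro conjI allI ballI)
    show "V (i + 5) = V i" for i
      using q_wrap[of "i + 1"] q_wrap[of "i + 4"] unfolding V_def by (simp add: add.assoc q_wrap)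
    show "V i \<noteq> {}" for i
      using q_out[of i] pent_q[of i] sym unfolding V_def pentagon_def by blast
    show "\<not> adj x y" if "x \<in> V i" "y \<in> V i" for x y i
      using Vq[OF that(1)] Vq[OF that(2)] tri[of x y "q (i + 1)"] q_out by blast
    show "adj x y" if xy: "x \<in> V i" "y \<in> V (i + 1)" for x y i
    proof (rule ccontr)
      assume "\<not> adj x y"
      moreover have "adj y (q (i + 2))" "\<not> adj y (q (i + 3))" "\<not> adj y (q (i + 4))"
        using Vq[OF xy(2)] by (simp_all add: add.assoc)
      ultimately show False
        using no_P5[of x "q (i + 4)" "q (i + 3)" "q (i + 2)" y] Vq[OF xy(1)] pent_q[of i] sym
        unfolding pentagon_def by blast
    qed
    show "\<not> adj x y" if xy: "x \<in> V i" "y \<in> V (i + 2)" for x y i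
    proof -
      have "adj y (q (i + 1))" using Vq(2)[OF xy(2)] by (simp add: add.assoc q_wrap)
      then show ?thesis using Vq[OF xy(1)] Vq(1)[OF xy(2)] tri[of x y "q (i + 1)"] q_out by blast
    qed
  qed
  moreover have "\<exists>k. z \<in> V k" if x: "x \<in> V i" and z: "adj x z" "z \<notin> S" for x z i
  proof -
    note xq = Vq[OF x]
    have n: "\<not> adj z (q (i + 1))" "\<not> adj z (q (i + 4))"
      using tri[of x z "q (i + 1)"] tri[of x z "q (i + 4)"] xq z q_out by blast+
    have pq: "pentagon x (q (i + 1)) (q (i + 2)) (q (i + 3)) (q (i + 4))"
      using pent_q[of i] xq sym unfolding pentagon_def by blast
    have "adj z (q (i + 2)) \<or> adj z (q (i + 3))"
      using pentagon_nbr_not_single[OF pq, of z] n z sym by blast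
    then show ?thesis
    proof
      assume z2: "adj z (q (i + 2))"
      then have "\<not> adj z (q (i + 3))"
        using tri[of z "q (i + 2)" "q (i + 3)"] z q_out pent_q[of i] unfolding pentagon_def by blast
      then have "adj z (q i)"
        using pentagon_nbr_not_single[of "q (i + 2)" "q (i + 3)" "q (i + 4)" "q i" "q (i + 1)" z]
          pent_q[of i] pentagon_rotate n z2 by blast
      then have "z \<in> V (i + 1)" using z z2 unfolding V_def by (simp add: add.assoc q_wrap)
      then show ?thesis by blast
    next
      assume z3: "adj z (q (i + 3))"
      have "adj z (q i)"
        using pentagon_nbr_not_single[of "q (i + 3)" "q (i + 4)" "q i" "q (i + 1)" "q (i + 2)" z]
          pent_q[of i] pentagon_rotate n z3 by blast
      then have "z \<in> V (i + 4)" using z z3 unfolding V_def by (simp add: add.assoc q_wrap)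
      then show ?thesis by blast
    qed
  qed
  moreover have "V i \<inter> S = {}" for i unfolding V_def by blast
  ultimately have "pentagon_blowup adj S V"
    using S by (unfold_locales) blast+
  moreover have "a \<in> V 0"
    using out p sym unfolding V_def q_def pentagon_def by simp
  ultimately show ?thesis by blast
qed

text \<open>Vertices that lie in no closed 3-colourable set form a closed set themselves. It contains no
  pentagon outside \<open>S\<close>, so it is bipartite up to \<open>S\<close>; hence it is empty.\<close>

theorem three_colourable: "colourable_on 3 UNIV"
proof -
  obtain S where S: "triangle_transversal adj S" using majority[of "[]"] by blast
  define good where "good = {v. \<exists>W. v \<in> W \<and> closed_in UNIV W \<and> colourable_on 3 W}"
  have "colourable_on 2 (- good - S)"
  proof (rule two_colourable_if_no_short_odd_cycle)
    show False if "a \<in> - good - S" "b \<in> - good - S" "c \<in> - good - S" "adj a b" "adj b c" "adj a c" for a b c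
      using S that unfolding triangle_transversal_def by blast
    show False if out: "a \<in> - good - S" "b \<in> - good - S" "c \<in> - good - S" "d \<in> - good - S" "e \<in> - good - S"
      and p: "pentagon a b c d e" for a b c d e
    proof -
      obtain V where blow: "pentagon_blowup adj S V" and aV: "a \<in> V 0"
        using pentagon_blowup_exists[OF S p] out by blast
      interpret pentagon_blowup adj S V by (rule blow)
      have "a \<in> bags \<union> touching \<union> fringe" using aV unfolding bags_def by blast
      with closed_neighbourhood neighbourhood_three_colourable have "a \<in> good"
        unfolding good_def by (intro CollectI exI conjI)
      then show False using out by blast
    qed
  qed
  then obtain f where f: "\<forall>v\<in>- good - S. f v < (2::nat)"
    "\<forall>u\<in>- good - S. \<forall>v\<in>- good - S. adj u v \<longrightarrow> f u \<noteq> f v"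
    unfolding colourable_on_def by blast
  have rest_col: "colourable_on 3 (- good)"
    unfolding colourable_on_def
  proof (intro exI conjI ballI impI)
    show "(if v \<in> S then 2 else f v) < 3" if "v \<in> - good" for v using f(1) that by force
    show "(if u \<in> S then 2 else f u) \<noteq> (if v \<in> S then 2 else f v)"
      if uv: "u \<in> - good" "v \<in> - good" "adj u v" for u v
    proof -
      have "\<not> (u \<in> S \<and> v \<in> S)" using S uv(3) unfolding triangle_transversal_def by blast
      moreover have "u \<notin> S \<Longrightarrow> f u < 2" "v \<notin> S \<Longrightarrow> f v < 2"
        "\<lbrakk>u \<notin> S; v \<notin> S\<rbrakk> \<Longrightarrow> f u \<noteq> f v"
        using f uv by blast+
      ultimately show ?thesis by (auto split: if_split)
    qed
  qed
  have rest_closed: "closed_in UNIV (- good)"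
  proof -
    have "v \<notin> good" if u: "u \<notin> good" and uv: "adj u v" for u v
    proof
      assume "v \<in> good"
      then obtain W where W: "v \<in> W" "closed_in UNIV W" "colourable_on 3 W" unfolding good_def by blast
      then have "u \<in> W" using sym[OF uv] unfolding closed_in_def by blast
      then show False using W u unfolding good_def by blast
    qed
    then show ?thesis unfolding closed_in_def by blast
  qed
  have "v \<in> good" for v
  proof (rule ccontr)
    assume "v \<notin> good"
    then have "v \<in> - good \<and> closed_in UNIV (- good) \<and> colourable_on 3 (- good)"
      using rest_col rest_closed by simp
    then have "\<exists>W. v \<in> W \<and> closed_in UNIV W \<and> colourable_on 3 W" by (rule exI)
    then have "v \<in> good" unfolding good_def by (rule CollectI)
    then show False using \<open>v \<notin> good\<close> by simp
  qed
  then have "\<exists>W. v \<in> W \<and> closed_in UNIV W \<and> colourable_on 3 W" for v unfolding good_def by simp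
  then show ?thesis by (rule colourable_on_if_locally)
qed

end

section \<open>Consequences of t-perfection\<close>

text \<open>The points with positive weight in a convex combination of \<open>x\<close> satisfy every valid inequality
  that is tight at \<open>x\<close>, and not all of them have a smaller value of \<open>w\<close> than \<open>x\<close> has.\<close>

lemma convex_hull_tight_point:
  fixes x :: "'v::real_vector"
  assumes fin: "finite X" and x: "x \<in> convex hull X" and lin: "linear w"
    and T: "\<And>g. g \<in> T \<Longrightarrow> linear g \<and> (\<forall>y\<in>X. g y \<le> (1::real)) \<and> g x = 1"
  obtains y where "y \<in> X" "\<And>g. g \<in> T \<Longrightarrow> g y = 1" "w x \<le> (w y :: real)"
proof -
  obtain u where u: "\<forall>y\<in>X. 0 \<le> u y" "sum u X = 1" "(\<Sum>y\<in>X. u y *\<^sub>R y) = x"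
    using x unfolding convex_hull_finite[OF fin] by blast
  have expand: "g x = (\<Sum>y\<in>X. u y * g y)" if "linear g" for g :: "'v \<Rightarrow> real"
    using u(3) linear_sum[OF that, of "\<lambda>y. u y *\<^sub>R y" X] linear_scale[OF that] by auto
  have tight: "g y = 1" if g: "g \<in> T" and y: "y \<in> X" "u y \<noteq> 0" for g y
  proof -
    have "(\<Sum>y\<in>X. u y * (1 - g y)) = 0"
      using expand[of g] T[OF g] u(2) by (simp add: right_diff_distrib sum_subtractf)
    then have "u y * (1 - g y) = 0"
      using sum_nonneg_eq_0_iff[OF fin, of "\<lambda>y. u y * (1 - g y)"] u(1) T[OF g] y by auto
    then show ?thesis using y by simp
  qed
  have "\<exists>y\<in>X. u y \<noteq> 0 \<and> w x \<le> w y"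
  proof (rule ccontr)
    assume "\<not> ?thesis"
    then have less: "\<And>y. y \<in> X \<Longrightarrow> u y \<noteq> 0 \<Longrightarrow> w y < w x" by force
    obtain y0 where y0: "y0 \<in> X" "u y0 \<noteq> 0" using u(2) by (metis sum.neutral zero_neq_one)
    have "(\<Sum>y\<in>X. u y * (w x - w y)) = 0"
      using expand[OF lin] u(2) by (simp add: right_diff_distrib sum_subtractf flip: sum_distrib_right)
    moreover have "\<forall>y\<in>X. 0 \<le> u y * (w x - w y)"
      using u(1) less by (metis less_eq_real_def mult_nonneg_nonneg diff_ge_0_iff_ge mult_zero_left)
    ultimately have "u y0 * (w x - w y0) = 0"
      using sum_nonneg_eq_0_iff[OF fin, of "\<lambda>y. u y * (w x - w y)"] y0(1) by blast
    then show False using y0 less[OF y0] by simp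
  qed
  then show ?thesis using that tight by blast
qed

lemma SSP_point_dominated:
  fixes G :: "'a::finite pair_pre_digraph" and w :: "real ^ 'a \<Rightarrow> real"
  assumes x: "x \<in> SSP G" and lin: "linear w"
    and T: "\<And>g. g \<in> T \<Longrightarrow> linear g \<and> (\<forall>S. stable_set G S \<longrightarrow> g (\<chi> v. indicator S v) \<le> (1::real)) \<and> g x = 1"
  obtains S where "stable_set G S" "\<And>g. g \<in> T \<Longrightarrow> g (\<chi> v. indicator S v) = 1"
    "w x \<le> w (\<chi> v. indicator S v)"
proof -
  let ?X = "{(\<chi> v. indicator S v) :: real ^ 'a | S. stable_set G S}"
  have "?X = (\<lambda>S. \<chi> v. indicator S v) ` {S. stable_set G S}" by blast
  then have "finite ?X" by simp
  then obtain y where y: "y \<in> ?X" "\<And>g. g \<in> T \<Longrightarrow> g y = 1" "w x \<le> w y"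
    using convex_hull_tight_point[of ?X x w T] x lin T unfolding SSP_def by blast
  then show ?thesis using that by blast
qed

lemma linear_sum_list_coordinates: "linear (\<lambda>x :: real ^ 'a. \<Sum>v\<leftarrow>vs. x $ v)"
proof (rule linearI)
  show "(\<Sum>v\<leftarrow>vs. (x + y) $ v) = (\<Sum>v\<leftarrow>vs. x $ v) + (\<Sum>v\<leftarrow>vs. y $ v)" for x y :: "real ^ 'a"
    by (simp add: sum_list_addf)
  show "(\<Sum>v\<leftarrow>vs. (r *\<^sub>R x) $ v) = r *\<^sub>R (\<Sum>v\<leftarrow>vs. x $ v)" for r and x :: "real ^ 'a"
    by (simp add: sum_list_const_mult)
qed

lemma lessThan_3_nat: "{..<3::nat} = {0, 1, 2}"
  by auto

lemma lessThan_5_nat: "{..<5::nat} = {0, 1, 2, 3, 4}"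
  by auto

lemma third_in_TSTAB:
  fixes G :: "'a::finite pair_pre_digraph"
  assumes "pair_wf_digraph G"
  shows "(\<chi> v. if v \<in> pverts G then 1/3 else 0) \<in> TSTAB G"
proof -
  let ?x = "(\<chi> v. if v \<in> pverts G then 1/3 else 0) :: real ^ 'a"
  have "(\<Sum>v\<in>f ` pverts (cycle_graph n). ?x $ v) \<le> real (n div 2)"
    if n: "odd n" "n \<ge> 3" and f: "induced_embedding (cycle_graph n) G f" for n f
  proof -
    have "(\<Sum>v\<in>f ` pverts (cycle_graph n). ?x $ v) \<le> (\<Sum>v\<in>f ` pverts (cycle_graph n). 1/3)"
      by (intro sum_mono) simp
    also have "\<dots> = real n / 3"
      using f by (simp add: induced_embedding_def cycle_graph_def card_image)
    also have "\<dots> \<le> real (n div 2)"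
      using n by (auto elim!: oddE)
    finally show ?thesis .
  qed
  then show ?thesis unfolding TSTAB_def by auto
qed

text \<open>The stable set obtained from the polytope is enlarged by all elements of the type that are not
  vertices; list entries that are not vertices are then counted fully.\<close>

lemma t_perfect_transversal_majority:
  fixes G :: "'a::finite pair_pre_digraph"
  assumes G: "pair_graph G" and t: "t_perfect G"
  shows "\<exists>S. triangle_transversal (\<lambda>u v. (u, v) \<in> parcs G) S \<and>
    length xs \<le> 3 * length (filter (\<lambda>x. x \<in> S) xs)"
proof -
  interpret pair_graph G by (rule G)
  let ?x = "(\<chi> v. if v \<in> pverts G then 1/3 else 0) :: real ^ 'a"
  define ys where "ys = filter (\<lambda>v. v \<in> pverts G) xs"
  define triangle where "triangle a b c \<longleftrightarrow> (a, b) \<in> parcs G \<and> (b, c) \<in> parcs G \<and> (a, c) \<in> parcs G" for a b c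
  define T where "T = {\<lambda>x :: real ^ 'a. \<Sum>v\<leftarrow>[a, b, c]. x $ v | a b c. triangle a b c}"
  have "?x \<in> SSP G"
    using third_in_TSTAB t pair_wf_digraph unfolding t_perfect_def by simp
  moreover have "linear g \<and> (\<forall>S. stable_set G S \<longrightarrow> g (\<chi> v. indicator S v) \<le> 1) \<and> g ?x = 1" if gT: "g \<in> T" for g
  proof -
    obtain a b c where g: "g = (\<lambda>x. \<Sum>v\<leftarrow>[a, b, c]. x $ v)" and abc: "triangle a b c"
      using gT unfolding T_def by blast
    have "g (\<chi> v. indicator S v) \<le> 1" if "stable_set G S" for S
    proof -
      have "\<not> (a \<in> S \<and> b \<in> S)" "\<not> (b \<in> S \<and> c \<in> S)" "\<not> (a \<in> S \<and> c \<in> S)"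
        using that abc unfolding stable_set_def triangle_def by blast+
      then show ?thesis unfolding g by (auto simp: indicator_def)
    qed
    moreover have "a \<in> pverts G" "b \<in> pverts G" "c \<in> pverts G"
      using abc in_arcsD1 in_arcsD2 unfolding triangle_def by blast+
    moreover have "linear g" unfolding g by (rule linear_sum_list_coordinates)
    moreover have "g ?x = 1" using calculation unfolding g by simp
    ultimately show ?thesis by blast
  qed
  ultimately obtain S where S: "stable_set G S" "\<And>g. g \<in> T \<Longrightarrow> g (\<chi> v. indicator S v) = 1"
    "(\<Sum>v\<leftarrow>ys. ?x $ v) \<le> (\<Sum>v\<leftarrow>ys. (\<chi> v. indicator S v) $ v)"
    using SSP_point_dominated[OF _ linear_sum_list_coordinates, of ?x G T ys] by blast
  let ?S = "S \<union> - pverts G"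
  have "triangle_transversal (\<lambda>u v. (u, v) \<in> parcs G) ?S"
    unfolding triangle_transversal_def
  proof (intro conjI allI impI ballI)
    show "(u, v) \<notin> parcs G" if "u \<in> ?S" "v \<in> ?S" for u v
      using S(1) that in_arcsD1 in_arcsD2 unfolding stable_set_def by blast
    show "a \<in> ?S \<or> b \<in> ?S \<or> c \<in> ?S" if "(a, b) \<in> parcs G" "(b, c) \<in> parcs G" "(a, c) \<in> parcs G" for a b c
    proof -
      have "(\<lambda>x. \<Sum>v\<leftarrow>[a, b, c]. x $ v) \<in> T" using that unfolding T_def triangle_def by blast
      from S(2)[OF this] show ?thesis by (auto simp: indicator_def split: if_splits)
    qed
  qed
  moreover have "length xs \<le> 3 * length (filter (\<lambda>x. x \<in> ?S) xs)"
  proof -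
    have sx: "(\<Sum>v\<leftarrow>ys. ?x $ v) = length ys / 3"
      unfolding ys_def by (induction xs) auto
    have sS: "(\<Sum>v\<leftarrow>ys. (\<chi> v. indicator S v) $ v) = real (length (filter (\<lambda>x. x \<in> S) ys))"
      by (induction ys) (auto simp: indicator_def)
    have "length ys \<le> 3 * length (filter (\<lambda>x. x \<in> S) ys)"
      using S(3) unfolding sx sS by linarith
    moreover have "length (filter (\<lambda>x. x \<in> ?S) xs) + length ys = length (filter (\<lambda>x. x \<in> S) ys) + length xs"
      using S(1) unfolding ys_def stable_set_def by (induction xs) auto
    moreover have "length ys \<le> length xs" unfolding ys_def by simp
    ultimately show ?thesis by linarith
  qed
  ultimately show ?thesis by blast
qed

text \<open>Give \<open>e\<close> the value \<open>2/3\<close> and the five other vertices \<open>1/3\<close>. The total is \<open>7/3\<close>, but no three of the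
  six vertices are independent. The vector is in \<open>TSTAB G\<close>: on a triangle at \<open>e\<close> at most one of the
  other two vertices has a nonzero value, because \<open>a\<close> and \<open>d\<close> are not adjacent; five vertices miss one of
  the six, and for longer cycles even the total is small enough.\<close>

lemma t_perfect_no_four_on_pentagon:
  fixes G :: "'a::finite pair_pre_digraph"
  assumes G: "pair_graph G" and t: "t_perfect G"
    and cycle: "(a, b) \<in> parcs G" "(b, c) \<in> parcs G" "(c, d) \<in> parcs G" "(d, e) \<in> parcs G" "(e, a) \<in> parcs G"
    and chords: "(a, c) \<notin> parcs G" "(a, d) \<notin> parcs G" "(b, d) \<notin> parcs G" "(b, e) \<notin> parcs G" "(c, e) \<notin> parcs G"
    and s: "(s, a) \<in> parcs G" "(s, b) \<in> parcs G" "(s, c) \<in> parcs G" "(s, d) \<in> parcs G" "(s, e) \<notin> parcs G"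
  shows False
proof -
  interpret pair_graph G by (rule G)
  have symG: "(u, v) \<in> parcs G \<Longrightarrow> (v, u) \<in> parcs G" for u v using arcs_symmetric by blast
  have irr: "(u, u) \<notin> parcs G" for u using pair_no_loops by fastforce
  let ?H = "{s, a, b, c, d, e}"
  define z where "z v = (if v = e then 2/3 else if v \<in> ?H then 1/3 else (0::real))" for v
  have distinct: "distinct [s, a, b, c, d, e]"
    using cycle chords s symG irr by auto
  have H: "?H \<subseteq> pverts G" using cycle s in_arcsD1 in_arcsD2 by blast
  have total: "(\<Sum>v\<in>?H. z v) = 7/3"
    using distinct unfolding z_def by (simp; auto)
  have z_nonneg: "0 \<le> z v" and z_le: "z v \<le> 2/3" for v unfolding z_def by auto
  have z_third: "z v \<le> 1/3" if "v \<noteq> e" for v using that unfolding z_def by auto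
  have "(\<chi> v. z v) \<in> TSTAB G"
    unfolding TSTAB_def
  proof (intro CollectI conjI allI ballI impI)
    show "(\<chi> v. z v) $ v = 0" if "v \<notin> pverts G" for v using that H unfolding z_def by auto
    show "0 \<le> (\<chi> v. z v) $ v" for v using z_nonneg by simp
    show "case p of (u, v) \<Rightarrow> (\<chi> v. z v) $ u + (\<chi> v. z v) $ v \<le> 1" if "p \<in> parcs G" for p
    proof (cases p)
      case (Pair u v)
      then have "u \<noteq> v" using that irr by blast
      then have "z u \<le> 1/3 \<or> z v \<le> 1/3" using z_third by metis
      then show ?thesis using Pair z_le[of u] z_le[of v] by auto
    qed
    fix n f
    assume nf: "odd n \<and> n \<ge> 3 \<and> induced_embedding (cycle_graph n) G f"
    let ?Q = "f ` pverts (cycle_graph n)"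
    have inj: "inj_on f {..<n}"
      and emb: "\<And>i j. i < n \<Longrightarrow> j < n \<Longrightarrow> (j = Suc i mod n \<or> i = Suc j mod n) \<longleftrightarrow> (f i, f j) \<in> parcs G"
      using nf unfolding induced_embedding_def cycle_graph_def by auto
    have card: "card ?Q = n" using inj by (simp add: cycle_graph_def card_image)
    have sum_H: "(\<Sum>v\<in>?Q. z v) = (\<Sum>v\<in>?Q \<inter> ?H. z v)"
      by (intro sum.mono_neutral_right) (auto simp: z_def cycle_graph_def)
    have "(\<Sum>v\<in>?Q. z v) \<le> real (n div 2)"
    proof -
      have "odd n" "n \<ge> 3" using nf by auto
      then have "n = 3 \<or> n = 5 \<or> n \<ge> 7" by presburger
      then consider "n = 3" | "n = 5" | "n \<ge> 7" by blast
      then show ?thesis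
      proof cases
        case 1
        have Q: "?Q = {f 0, f 1, f 2}" using 1 by (simp add: cycle_graph_def lessThan_3_nat)
        have f: "f 0 \<noteq> f 1" "f 0 \<noteq> f 2" "f 1 \<noteq> f 2"
          using inj_on_eq_iff[OF inj, of 0 1] inj_on_eq_iff[OF inj, of 0 2] inj_on_eq_iff[OF inj, of 1 2] 1
          by simp_all
        have arcs: "(f 0, f 1) \<in> parcs G" "(f 1, f 2) \<in> parcs G" "(f 0, f 2) \<in> parcs G"
          using emb[of 0 1] emb[of 1 2] emb[of 0 2] 1 by auto
        have pair: "z u + z v \<le> 1/3" if "(e, u) \<in> parcs G" "(e, v) \<in> parcs G" "(u, v) \<in> parcs G" for u v
        proof -
          have N: "x \<noteq> e \<and> (z x = 0 \<or> x = a \<or> x = d)" if "(e, x) \<in> parcs G" for x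
          proof -
            have "x \<noteq> e" "x \<noteq> s" "x \<noteq> b" "x \<noteq> c" using that s(5) chords(4,5) symG irr by blast+
            then show ?thesis unfolding z_def by simp
          qed
          have "\<not> (u \<in> {a, d} \<and> v \<in> {a, d})" using that(3) chords(2) symG irr by blast
          then have "z u = 0 \<or> z v = 0" using N[OF that(1)] N[OF that(2)] by blast
          moreover have "z u \<le> 1/3" "z v \<le> 1/3" using N that(1,2) z_third by blast+
          ultimately show ?thesis by linarith
        qed
        have "z (f 0) + z (f 1) + z (f 2) \<le> 1"
        proof -
          have "z (f 1) + z (f 2) \<le> 1/3 \<or> z (f 0) \<le> 1/3"
            "z (f 0) + z (f 2) \<le> 1/3 \<or> z (f 1) \<le> 1/3"
            "z (f 0) + z (f 1) \<le> 1/3 \<or> z (f 2) \<le> 1/3"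
            using pair[of "f 1" "f 2"] pair[of "f 0" "f 2"] pair[of "f 0" "f 1"] arcs
              symG[OF arcs(1)] symG[OF arcs(2)] symG[OF arcs(3)] z_third by metis+
          then show ?thesis using z_le[of "f 0"] z_le[of "f 1"] z_le[of "f 2"] by linarith
        qed
        then show ?thesis using 1 f unfolding Q by simp
      next
        case 2
        have "\<not> ?H \<subseteq> ?Q"
          using card_mono[of ?Q ?H] card 2 distinct by (auto simp: cycle_graph_def)
        then obtain h where h: "h \<in> ?H" "h \<notin> ?Q" by blast
        have "(\<Sum>v\<in>?Q \<inter> ?H. z v) \<le> (\<Sum>v\<in>?H - {h}. z v)"
          using h z_nonneg by (intro sum_mono2) auto
        also have "\<dots> = 7/3 - z h" using total h(1) by (simp add: sum_diff1 del: insert_iff)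
        also have "\<dots> \<le> 2" using h(1) unfolding z_def by auto
        finally show ?thesis using 2 sum_H by simp
      next
        case 3
        have "(\<Sum>v\<in>?Q \<inter> ?H. z v) \<le> (\<Sum>v\<in>?H. z v)"
          using z_nonneg by (intro sum_mono2) auto
        then show ?thesis using total sum_H 3 by simp
      qed
    qed
    then show "(\<Sum>v\<in>?Q. (\<chi> v. z v) $ v) \<le> real (n div 2)" by simp
  qed
  then have "(\<chi> v. z v) \<in> SSP G" using t unfolding t_perfect_def by simp
  then obtain S where S: "stable_set G S"
    "(\<Sum>v\<leftarrow>[s, a, b, c, d, e]. (\<chi> v. z v) $ v) \<le> (\<Sum>v\<leftarrow>[s, a, b, c, d, e]. (\<chi> v. indicator S v) $ v)"
    using SSP_point_dominated[OF _ linear_sum_list_coordinates, of "\<chi> v. z v" G "{}" "[s, a, b, c, d, e]"]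
    by blast
  have "(\<Sum>v\<leftarrow>[s, a, b, c, d, e]. (\<chi> v. z v) $ v) = 7/3"
    using distinct unfolding z_def by simp
  then have "7/3 \<le> (\<Sum>v\<leftarrow>[s, a, b, c, d, e]. of_bool (v \<in> S) :: real)"
    using S(2) by (simp add: indicator_def)
  also have "\<dots> \<le> 2"
  proof -
    have "\<not> (s \<in> S \<and> a \<in> S)" "\<not> (s \<in> S \<and> b \<in> S)" "\<not> (s \<in> S \<and> c \<in> S)" "\<not> (s \<in> S \<and> d \<in> S)"
      "\<not> (a \<in> S \<and> b \<in> S)" "\<not> (b \<in> S \<and> c \<in> S)" "\<not> (c \<in> S \<and> d \<in> S)" "\<not> (d \<in> S \<and> e \<in> S)"
      "\<not> (e \<in> S \<and> a \<in> S)"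
      using S(1) cycle s unfolding stable_set_def by blast+
    then show ?thesis
      by (cases "s \<in> S"; cases "a \<in> S"; cases "b \<in> S"; cases "c \<in> S"; cases "d \<in> S"; cases "e \<in> S"; simp)
  qed
  finally show False by simp
qed

theorem theorem23:
  fixes G :: "'a::finite pair_pre_digraph"
  assumes "pair_graph G"
    and "induced_free (path_graph 5) G"
    and "t_perfect G"
  shows "colourable 3 G"
proof -
  interpret pair_graph G by (rule assms(1))
  let ?adj = "\<lambda>u v. (u, v) \<in> parcs G"
  have symG: "?adj u v \<Longrightarrow> ?adj v u" for u v using arcs_symmetric by blast
  have irr: "\<not> ?adj u u" for u using pair_no_loops by fastforce
  interpret P5_free ?adj
  proof
    show "?adj v u" if "?adj u v" for u v using symG that .
    show "\<not> ?adj v v" for v by (rule irr)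
    show False if p: "?adj a b" "?adj b c" "?adj c d" "?adj d e" "\<not> ?adj a c" "\<not> ?adj a d" "\<not> ?adj a e"
      "\<not> ?adj b d" "\<not> ?adj b e" "\<not> ?adj c e" for a b c d e
    proof -
      have V: "a \<in> pverts G" "b \<in> pverts G" "c \<in> pverts G" "d \<in> pverts G" "e \<in> pverts G"
        using p in_arcsD1 in_arcsD2 by blast+
      have "distinct [a, b, c, d, e]" using p symG irr by auto
      then have "induced_embedding (path_graph 5) G ((!) [a, b, c, d, e])"
        using V p symG irr unfolding induced_embedding_def path_graph_def inj_on_def
        by (simp add: lessThan_5_nat) blast
      then show False using assms(2) unfolding induced_free_def by blast
    qed
  qed
  interpret majority_P5_free ?adj
  proof
    show "\<exists>S. triangle_transversal ?adj S \<and> length xs \<le> 3 * length (filter (\<lambda>x. x \<in> S) xs)" for xs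
      using t_perfect_transversal_majority[OF assms(1,3)] .
    show False if "pentagon a b c d e" "?adj s a" "?adj s b" "?adj s c" "?adj s d" "\<not> ?adj s e" for a b c d e s
      using t_perfect_no_four_on_pentagon[OF assms(1,3)] that unfolding pentagon_def by blast
  qed
  show ?thesis using three_colourable unfolding colourable_on_def colourable_def by fast
qed

end
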